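(* Let $d\ge 2$ and let $\mathbf w=(w_1,\ldots,w_d)\in\mathbb R^d$ satisfy $w_1\ge\cdots\ge w_d>0$ and $\sum_{i=1}^d w_i=1$. There exist constants $C_{d,\mathbf w}>0$ and $\varepsilon_0=\varepsilon_0(d,\mathbf w)>0$ such that $$\dim_H \operatorname{DI}_{\mathbf w}(\varepsilon)\le d-\frac1{1+w_1}+C_{d,\mathbf w}\sqrt{\varepsilon}$$ for every $0<\varepsilon<\varepsilon_0$.
   Context: For $y\in\mathbb R^d$ write $\|y\|_{\mathbf w}=\max_{1\le i\le d}|y_i|^{1/w_i}$. For $\varepsilon>0$, $\operatorname{DI}_{\mathbf w}(\varepsilon)$ is the set of $x\in\mathbb R^d$ such that for every sufficiently large $T$ there exists $(p,q)\in\mathbb Z^d\times\mathbb N$ (with $\mathbb N$ the positive integers) such that $0<q<T$ and $\|qx-p\|_{\mathbf w}<\varepsilon/T$. $\dim_H$ is Hausdorff dimension with respect to the Euclidean metric on $\mathbb R^d$. *)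

theory Defs
  imports "HOL-Analysis.Analysis"
begin

text \<open>The contribution \<open>diam(U)^s\<close> of a set to a Hausdorff sum, with the usual conventions
  \<open>diam({})^s = 0\<close> and \<open>0^0 = 1\<close> for nonempty sets (whereas \<open>0 powr 0 = 0\<close>). Meant for bounded sets
  only, since \<open>diameter U\<close> is unspecified for unbounded \<open>U\<close>.\<close>

definition hausdorff_gauge :: "real \<Rightarrow> 'a::metric_space set \<Rightarrow> ennreal" where
  "hausdorff_gauge s U =
     (if U = {} then 0 else if s = 0 then 1 else ennreal (diameter U powr s))"

definition hausdorff_content :: "real \<Rightarrow> real \<Rightarrow> 'a::metric_space set \<Rightarrow> ennreal" where
  "hausdorff_content s \<delta> A =
     (INF U \<in> {U :: nat \<Rightarrow> 'a set. A \<subseteq> (\<Union>i. U i) \<and> (\<forall>i. bounded (U i) \<and> diameter (U i) \<le> \<delta>)}.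
        \<Sum>i. hausdorff_gauge s (U i))"

definition hausdorff_measure :: "real \<Rightarrow> 'a::metric_space set \<Rightarrow> ennreal" where
  "hausdorff_measure s A = (SUP \<delta> \<in> {0<..}. hausdorff_content s \<delta> A)"

text \<open>Extended-real valued: the value is \<open>\<infinity>\<close> if no \<open>s\<close> qualifies.\<close>

definition hausdorff_dim :: "'a::metric_space set \<Rightarrow> ereal" where
  "hausdorff_dim A = (INF s \<in> {s. 0 \<le> s \<and> hausdorff_measure s A = 0}. ereal s)"

definition wnorm :: "real ^ 'd \<Rightarrow> real ^ 'd \<Rightarrow> real" where
  "wnorm w y = (MAX i. \<bar>y $ i\<bar> powr (1 / w $ i))"

definition DI :: "real ^ 'd \<Rightarrow> real \<Rightarrow> (real ^ 'd) set" where
  "DI w \<epsilon> = {x. \<forall>\<^sub>F T :: real in at_top.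
     \<exists>(p :: int ^ 'd) (q :: nat). 0 < q \<and> real q < T \<and>
       wnorm w (real q *\<^sub>R x - (\<chi> i. real_of_int (p $ i))) < \<epsilon> / T}"

end

theory Submission
  imports Defs
begin

text \<open>Let \<open>d\<close> be the dimension and \<open>x\<close> a point of \<open>DI w \<epsilon>\<close>. If \<open>v, v'\<close> are consecutive best approximations
  of \<open>x\<close> with denominators \<open>q < q'\<close>, then the residue of \<open>v\<close> is less than \<open>\<epsilon> / q'\<close>, and a tube of length
  \<open>q'\<close> around \<open>x\<close>, as wide as this residue, contains no nonzero lattice points. Covering the region of all
  possible \<open>v'\<close> by translates of the tube shows that, for \<open>q' / q\<close> of order \<open>\<tau>\<close>, there are \<open>O(\<tau>^(d-1))\<close> of them
  if they lie in a hyperplane; otherwise a transference argument bounds their number by \<open>O(\<epsilon> \<tau>^d)\<close>.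

  By Dirichlet's principle each \<open>v\<close> lies in a rational hyperplane \<open>H\<close> with small coefficients. The following
  best approximations stay in \<open>H\<close> for a while. There are \<open>O(\<sigma>^d)\<close> candidates of denominator about \<open>\<sigma> q\<close> for
  the last of them, \<open>u\<close>, and the denominator of its successor \<open>z\<close> outside \<open>H\<close> exceeds that of \<open>u\<close> by a
  factor of at least a constant times \<open>(\<sigma> / \<epsilon>)^c\<close>. Therefore the sum of \<open>(q / q_z)^(d+\<kappa>)\<close> over all \<open>u\<close> and \<open>z\<close>
  is \<open>O(\<epsilon> / \<kappa>^2 + \<epsilon>^(c/2))\<close>, which is less than \<open>1/2\<close> if \<open>\<kappa>\<close> is a large multiple of \<open>\<surd>\<epsilon>\<close>. So the
  weights \<open>q^-(d+\<kappa>)\<close> of the generations of the tree of transitions \<open>v \<mapsto> z\<close> decay geometrically, and covering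
  the boxes around the points \<open>v\<close> of one generation by cubes of side \<open>q^-(1+w_1)\<close> gives the bound.\<close>

section \<open>Counting separated points\<close>

text \<open>Points at sup-distance at least 1 have different coordinatewise floors, so they inject
  into the integer points of a box.\<close>

lemma separated_count:
  fixes f :: "'a \<Rightarrow> 'n::finite \<Rightarrow> real"
  assumes sep: "\<And>a b. a \<in> A \<Longrightarrow> b \<in> A \<Longrightarrow> a \<noteq> b \<Longrightarrow> \<exists>i. 1 \<le> \<bar>f a i - f b i\<bar>"
    and bound: "\<And>a i. a \<in> A \<Longrightarrow> \<bar>f a i\<bar> \<le> R i"
    and R: "\<And>i. 0 \<le> R i"
  shows "finite A" and "real (card A) \<le> (\<Prod>i\<in>UNIV. 2 * R i + 2)"
proof -
  define \<phi> where "\<phi> a = (\<lambda>i. \<lfloor>f a i\<rfloor>)" for a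
  define B where "B = PiE UNIV (\<lambda>i. {\<lfloor>- R i\<rfloor>..\<lfloor>R i\<rfloor>})"
  have inj: "inj_on \<phi> A"
  proof (rule inj_onI, rule ccontr)
    fix a b assume ab: "a \<in> A" "b \<in> A" "\<phi> a = \<phi> b" "a \<noteq> b"
    then obtain i where i: "1 \<le> \<bar>f a i - f b i\<bar>" using sep by blast
    have "\<lfloor>f a i\<rfloor> = \<lfloor>f b i\<rfloor>" using ab(3) by (auto simp: \<phi>_def fun_eq_iff)
    then show False using i by linarith
  qed
  have sub: "\<phi> ` A \<subseteq> B"
  proof
    fix y assume "y \<in> \<phi> ` A"
    then obtain a where a: "a \<in> A" "y = \<phi> a" by auto
    have "\<lfloor>- R i\<rfloor> \<le> \<lfloor>f a i\<rfloor> \<and> \<lfloor>f a i\<rfloor> \<le> \<lfloor>R i\<rfloor>" for i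
      using bound[OF a(1), of i] by (auto intro!: floor_mono simp: abs_le_iff)
    then show "y \<in> B" by (auto simp: a(2) \<phi>_def B_def)
  qed
  have finB: "finite B" unfolding B_def by (intro finite_PiE) auto
  show "finite A"
    using finite_imageD[OF finite_subset[OF sub finB] inj] .
  have "card A = card (\<phi> ` A)" using card_image[OF inj] by simp
  also have "\<dots> \<le> card B" using card_mono[OF finB sub] .
  also have "\<dots> = (\<Prod>i\<in>UNIV. card {\<lfloor>- R i\<rfloor>..\<lfloor>R i\<rfloor>})"
    unfolding B_def by (simp add: card_PiE)
  finally have "real (card A) \<le> (\<Prod>i\<in>UNIV. real (card {\<lfloor>- R i\<rfloor>..\<lfloor>R i\<rfloor>}))"
    by (metis of_nat_le_iff of_nat_prod)
  also have "\<dots> \<le> (\<Prod>i\<in>UNIV. 2 * R i + 2)"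
  proof (rule prod_mono)
    fix i :: 'n
    have "0 \<le> \<lfloor>R i\<rfloor> - \<lfloor>- R i\<rfloor> + 1" using R[of i] by linarith
    then have "real (card {\<lfloor>- R i\<rfloor>..\<lfloor>R i\<rfloor>}) = real_of_int (\<lfloor>R i\<rfloor> - \<lfloor>- R i\<rfloor> + 1)" by simp
    also have "\<dots> \<le> 2 * R i + 2" by linarith
    finally show "0 \<le> real (card {\<lfloor>- R i\<rfloor>..\<lfloor>R i\<rfloor>}) \<and> real (card {\<lfloor>- R i\<rfloor>..\<lfloor>R i\<rfloor>}) \<le> 2 * R i + 2"
      by simp
  qed
  finally show "real (card A) \<le> (\<Prod>i\<in>UNIV. 2 * R i + 2)" .
qed

text \<open>A bound on one linear form saves one factor of order \<open>R\<close>: dividing the form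
  by its largest coefficient gives a coordinate that can replace \<open>i0\<close> and is bounded by
  \<open>K\<close>.\<close>

lemma slab_count:
  fixes f :: "'a \<Rightarrow> 'n::finite \<Rightarrow> real" and c :: "'n \<Rightarrow> real"
  assumes sep: "\<And>a b. a \<in> A \<Longrightarrow> b \<in> A \<Longrightarrow> a \<noteq> b \<Longrightarrow> \<exists>i. 1 \<le> \<bar>f a i - f b i\<bar>"
    and bound: "\<And>a i. a \<in> A \<Longrightarrow> \<bar>f a i\<bar> \<le> R"
    and R: "0 \<le> R" and K: "0 \<le> K"
    and c0: "c i0 \<noteq> 0" and cmax: "\<And>i. \<bar>c i\<bar> \<le> \<bar>c i0\<bar>"
    and slab: "\<And>a. a \<in> A \<Longrightarrow> \<bar>\<Sum>i\<in>UNIV. c i * f a i\<bar> \<le> K * \<bar>c i0\<bar>"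
  shows "finite A"
    and "real (card A) \<le> (4 * K + 2) * (4 * real CARD('n) * R + 2) ^ (CARD('n) - 1)"
proof -
  let ?n = "real CARD('n)"
  define \<phi> where "\<phi> a = (\<Sum>i\<in>UNIV. c i * f a i) / c i0" for a
  \<comment> \<open>The weights keep the new coordinates separated. If two images differ by less
    than 1 everywhere, then the normalised form \<open>\<phi>\<close> and the sum of the remaining
    terms contribute at most 1/2 each to the difference in coordinate \<open>i0\<close>, so the old
    points were too close.\<close>
  define g where "g a i = (if i = i0 then 2 * \<phi> a else 2 * ?n * f a i)" for a i
  define S where "S i = (if i = i0 then 2 * K else 2 * ?n * R)" for i
  have n: "?n \<ge> 1" by (simp add: Suc_leI)
  have phi: "f a i0 = \<phi> a - (\<Sum>i\<in>UNIV - {i0}. c i / c i0 * f a i)" for a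
  proof -
    have "\<phi> a = (\<Sum>i\<in>UNIV. c i / c i0 * f a i)"
      by (simp add: \<phi>_def sum_divide_distrib)
    also have "\<dots> = f a i0 + (\<Sum>i\<in>UNIV - {i0}. c i / c i0 * f a i)"
      using c0 by (simp add: sum.remove[of UNIV i0])
    finally show ?thesis by simp
  qed
  have sepg: "\<exists>i. 1 \<le> \<bar>g a i - g b i\<bar>" if ab: "a \<in> A" "b \<in> A" "a \<noteq> b" for a b
  proof (rule ccontr)
    assume "\<not> ?thesis"
    then have lt: "\<bar>g a i - g b i\<bar> < 1" for i by (meson not_less)
    have small: "\<bar>f a i - f b i\<bar> < 1 / (2 * ?n)" if "i \<noteq> i0" for i
    proof -
      have "2 * ?n * \<bar>f a i - f b i\<bar> = \<bar>g a i - g b i\<bar>"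
        using that n by (simp add: g_def abs_mult flip: right_diff_distrib)
      then show ?thesis using lt[of i] n by (simp add: field_simps)
    qed
    have "\<bar>\<phi> a - \<phi> b\<bar> < 1 / 2" using lt[of i0] unfolding g_def if_P[OF refl] by linarith
    moreover have "\<bar>\<Sum>i\<in>UNIV - {i0}. c i / c i0 * (f a i - f b i)\<bar> \<le> 1 / 2"
    proof -
      have "\<bar>\<Sum>i\<in>UNIV - {i0}. c i / c i0 * (f a i - f b i)\<bar>
          \<le> (\<Sum>i\<in>UNIV - {i0}. \<bar>c i / c i0 * (f a i - f b i)\<bar>)" by (rule sum_abs)
      also have "\<dots> \<le> (\<Sum>i\<in>UNIV - {i0}. 1 / (2 * ?n))"
      proof (rule sum_mono)
        fix i assume i: "i \<in> UNIV - {i0}"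
        have "\<bar>c i / c i0\<bar> \<le> 1" using cmax[of i] c0 by (simp add: abs_divide divide_le_eq)
        then have "\<bar>c i / c i0\<bar> * \<bar>f a i - f b i\<bar> \<le> 1 * (1 / (2 * ?n))"
          using small[of i] i by (intro mult_mono) auto
        then show "\<bar>c i / c i0 * (f a i - f b i)\<bar> \<le> 1 / (2 * ?n)" by (simp add: abs_mult)
      qed
      also have "\<dots> \<le> (\<Sum>i\<in>(UNIV::'n set). 1 / (2 * ?n))"
        by (rule sum_mono2) auto
      also have "\<dots> = 1 / 2" using n by simp
      finally show ?thesis .
    qed
    moreover have "f a i0 - f b i0 = (\<phi> a - \<phi> b) - (\<Sum>i\<in>UNIV - {i0}. c i / c i0 * (f a i - f b i))"
      by (simp add: phi right_diff_distrib sum_subtractf)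
    ultimately have z: "\<bar>f a i0 - f b i0\<bar> < 1" by linarith
    obtain i where i: "1 \<le> \<bar>f a i - f b i\<bar>" using sep[OF ab] by blast
    show False
    proof (cases "i = i0")
      case True then show False using z i by simp
    next
      case False
      have "1 \<le> 2 * ?n" using n by linarith
      then have "1 / (2 * ?n) \<le> 1" by (subst divide_le_eq_1) auto
      then show False using small[OF False] i by linarith
    qed
  qed
  have bdg: "\<bar>g a i\<bar> \<le> S i" if "a \<in> A" for a i
  proof (cases "i = i0")
    case True
    have "\<bar>\<phi> a\<bar> \<le> K" using slab[OF that] c0 by (simp add: \<phi>_def abs_divide divide_le_eq)
    then show ?thesis using True by (simp add: g_def S_def)
  next
    case False
    then show ?thesis using bound[OF that, of i] n by (simp add: g_def S_def abs_mult)
  qed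
  have S0: "0 \<le> S i" for i using K R by (simp add: S_def)
  note sc = separated_count[of A g S, OF sepg bdg S0]
  show "finite A" by (rule sc(1))
  have "real (card A) \<le> (\<Prod>i\<in>UNIV. 2 * S i + 2)" by (rule sc(2))
  also have "\<dots> = (2 * S i0 + 2) * (\<Prod>i\<in>UNIV - {i0}. 2 * S i + 2)"
    by (rule prod.remove) auto
  also have "(\<Prod>i\<in>UNIV - {i0}. 2 * S i + 2) = (\<Prod>i\<in>UNIV - {i0}. 4 * ?n * R + 2)"
    by (intro prod.cong refl) (simp add: S_def)
  also have "\<dots> = (4 * ?n * R + 2) ^ (CARD('n) - 1)"
    unfolding prod_constant by (subst card_Diff_subset) auto
  also have "2 * S i0 + 2 = 4 * K + 2" by (simp add: S_def)
  finally show "real (card A) \<le> (4 * K + 2) * (4 * ?n * R + 2) ^ (CARD('n) - 1)" .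
qed

section \<open>Exponential sums modulo \<open>q\<close> and a transference count\<close>

lemma sum_cis_multiple:
  fixes q :: nat and m :: int
  assumes q: "q > 0"
  shows "(\<Sum>s<q. cis (2 * pi * real s * real_of_int m / real q)) = (if int q dvd m then of_nat q else 0)"
proof -
  define \<omega> where "\<omega> = cis (2 * pi * real_of_int m / real q)"
  have pw: "cis (2 * pi * real s * real_of_int m / real q) = \<omega> ^ s" for s
    unfolding \<omega>_def Complex.DeMoivre by (rule arg_cong[of _ _ cis]) (simp add: mult_ac)
  have iff: "\<omega> = 1 \<longleftrightarrow> int q dvd m"
  proof
    assume "\<omega> = 1"
    then have "cos (2 * pi * real_of_int m / real q) = 1" by (simp add: \<omega>_def complex_eq_iff)
    then obtain n :: int where "2 * pi * real_of_int m / real q = of_int n * (2 * pi)"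
      by (auto simp: cos_one_2pi_int)
    then have "real_of_int m = real_of_int (n * int q)" using q by (simp add: field_simps)
    then have "m = n * int q" by (simp only: of_int_eq_iff)
    then show "int q dvd m" by simp
  next
    assume "int q dvd m"
    then obtain n where n: "m = int q * n" by blast
    have "2 * pi * real_of_int m / real q = 2 * pi * real_of_int n" using q by (simp add: n)
    then show "\<omega> = 1" by (simp add: \<omega>_def cis_multiple_2pi)
  qed
  have "\<omega> ^ q = cis (2 * pi * real_of_int m)"
    using q unfolding \<omega>_def Complex.DeMoivre by simp
  then have w1: "\<omega> ^ q = 1" by (simp add: cis_multiple_2pi)
  show ?thesis
  proof (cases "int q dvd m")
    case True
    then show ?thesis using iff by (simp add: pw)
  next
    case False
    then have "(\<Sum>s<q. \<omega> ^ s) = (\<omega> ^ q - 1) / (\<omega> - 1)" using iff by (intro geometric_sum) auto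
    then show ?thesis using False w1 by (simp add: pw)
  qed
qed

text \<open>This is Parseval for the indicator of \<open>K\<close>, whose elements are distinct
  modulo \<open>q\<close>: the squares of its Fourier transform \<open>g\<close> add up to
  \<open>q * card K\<close>, while on \<open>S\<close> each of them is at least
  \<open>(card K / 2)^2\<close>.\<close>

lemma bohr_count:
  fixes q :: nat and K :: "int set" and S :: "nat set"
  assumes q: "q > 0" and K: "finite K" and S: "S \<subseteq> {..<q}"
    and inj: "\<And>k l. k \<in> K \<Longrightarrow> l \<in> K \<Longrightarrow> int q dvd k - l \<Longrightarrow> k = l"
    and cs: "\<And>s k. s \<in> S \<Longrightarrow> k \<in> K \<Longrightarrow> 1 / 2 \<le> cos (2 * pi * real s * real_of_int k / real q)"
  shows "card S * card K \<le> 4 * q"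
proof (cases "card K = 0")
  case True then show ?thesis by simp
next
  case False
  define g where "g s = (\<Sum>k\<in>K. cis (2 * pi * real s * real_of_int k / real q))" for s :: nat
  have gg: "complex_of_real ((cmod (g s))\<^sup>2) =
     (\<Sum>k\<in>K. \<Sum>l\<in>K. cis (2 * pi * real s * real_of_int (k - l) / real q))" for s
  proof -
    have "complex_of_real ((cmod (g s))\<^sup>2) = g s * cnj (g s)" by (rule complex_norm_square)
    also have "\<dots> = (\<Sum>k\<in>K. \<Sum>l\<in>K. cis (2 * pi * real s * real_of_int k / real q)
        * cnj (cis (2 * pi * real s * real_of_int l / real q)))"
      by (simp add: g_def sum_product)
    also have "\<dots> = (\<Sum>k\<in>K. \<Sum>l\<in>K. cis (2 * pi * real s * real_of_int (k - l) / real q))"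
      by (intro sum.cong refl) (simp add: cis_cnj cis_mult right_diff_distrib diff_divide_distrib)
    finally show ?thesis .
  qed
  have "complex_of_real (\<Sum>s<q. (cmod (g s))\<^sup>2) =
     (\<Sum>s<q. \<Sum>k\<in>K. \<Sum>l\<in>K. cis (2 * pi * real s * real_of_int (k - l) / real q))"
    using gg by simp
  also have "\<dots> = (\<Sum>k\<in>K. \<Sum>s<q. \<Sum>l\<in>K. cis (2 * pi * real s * real_of_int (k - l) / real q))"
    by (rule sum.swap)
  also have "\<dots> = (\<Sum>k\<in>K. \<Sum>l\<in>K. \<Sum>s<q. cis (2 * pi * real s * real_of_int (k - l) / real q))"
    by (intro sum.cong refl sum.swap)
  also have "\<dots> = (\<Sum>k\<in>K. \<Sum>l\<in>K. if l = k then of_nat q else 0)"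
    using inj by (intro sum.cong refl) (simp only: sum_cis_multiple[OF q], auto)
  also have "\<dots> = of_nat (card K * q)" using K by simp
  finally have total: "(\<Sum>s<q. (cmod (g s))\<^sup>2) = real (card K * q)"
    by (metis of_real_eq_iff of_real_of_nat_eq)
  have low: "(real (card K) / 2)\<^sup>2 \<le> (cmod (g s))\<^sup>2" if "s \<in> S" for s
  proof -
    have "real (card K) / 2 = (\<Sum>k\<in>K. 1 / 2)" by simp
    also have "\<dots> \<le> (\<Sum>k\<in>K. cos (2 * pi * real s * real_of_int k / real q))"
      by (intro sum_mono cs that)
    also have "\<dots> = Re (g s)" by (simp add: g_def)
    also have "\<dots> \<le> cmod (g s)" by (rule complex_Re_le_cmod)
    finally show ?thesis by (intro power_mono) auto
  qed
  have "real (card S) * (real (card K) / 2)\<^sup>2 = (\<Sum>s\<in>S. (real (card K) / 2)\<^sup>2)" by simp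
  also have "\<dots> \<le> (\<Sum>s\<in>S. (cmod (g s))\<^sup>2)" by (intro sum_mono low)
  also have "\<dots> \<le> (\<Sum>s<q. (cmod (g s))\<^sup>2)" using S by (intro sum_mono2) auto
  also have "\<dots> = real (card K) * real q" by (simp add: total)
  finally have "real (card S) * real (card K) * real (card K) \<le> 4 * real q * real (card K)"
    by (simp add: power2_eq_square field_simps)
  then have "real (card S) * real (card K) \<le> 4 * real q" using False by simp
  then show ?thesis by (metis of_nat_le_iff of_nat_mult of_nat_numeral)
qed

lemma card_int_box:
  fixes t W :: "'n::finite \<Rightarrow> real"
  assumes "\<And>i. 0 \<le> W i"
  shows "finite {z :: 'n \<Rightarrow> int. \<forall>i. \<bar>of_int (z i) - t i\<bar> \<le> W i}"
    and "real (card {z :: 'n \<Rightarrow> int. \<forall>i. \<bar>of_int (z i) - t i\<bar> \<le> W i}) \<le> (\<Prod>i\<in>UNIV. 2 * W i + 2)"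
proof -
  let ?A = "{z :: 'n \<Rightarrow> int. \<forall>i. \<bar>of_int (z i) - t i\<bar> \<le> W i}"
  have sep: "\<exists>i. 1 \<le> \<bar>(of_int (z i) - t i) - (of_int (z' i) - t i)\<bar>"
    if zz: "z \<in> ?A" "z' \<in> ?A" "z \<noteq> z'" for z z' :: "'n \<Rightarrow> int"
  proof -
    obtain i where "z i \<noteq> z' i" using zz(3) by blast
    then have "1 \<le> \<bar>z i - z' i\<bar>" by linarith
    then have "1 \<le> \<bar>real_of_int (z i) - real_of_int (z' i)\<bar>" by linarith
    then show ?thesis by (intro exI[of _ i]) simp
  qed
  note sc = separated_count[of ?A "\<lambda>z i. of_int (z i) - t i" W, OF sep _ assms]
  show "finite ?A" by (rule sc(1)) auto
  show "real (card ?A) \<le> (\<Prod>i\<in>UNIV. 2 * W i + 2)" by (rule sc(2)) auto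
qed

lemma card_residue:
  fixes q s :: int and L :: real
  assumes q: "q > 0" and L: "L \<ge> 1"
  shows "finite {z. z mod q = s \<and> L * q \<le> real_of_int z \<and> real_of_int z < 2 * L * q}"
    and "real (card {z. z mod q = s \<and> L * q \<le> real_of_int z \<and> real_of_int z < 2 * L * q}) \<le> 6 * L"
proof -
  let ?A = "{z. z mod q = s \<and> L * q \<le> real_of_int z \<and> real_of_int z < 2 * L * q}"
  \<comment> \<open>There is one coordinate, \<open>z / q\<close>, indexed by the type
    \<open>unit\<close>.\<close>
  have sep: "\<exists>i::unit. 1 \<le> \<bar>real_of_int z / q - real_of_int z' / q\<bar>" if "z \<in> ?A" "z' \<in> ?A" "z \<noteq> z'" for z z'
  proof -
    have "q dvd z - z'" using that by (metis (mono_tags, lifting) mem_Collect_eq mod_eq_dvd_iff)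
    then obtain k where k: "z - z' = q * k" by blast
    then have "k \<noteq> 0" using that by auto
    then have "1 \<le> \<bar>real_of_int k\<bar>" by linarith
    moreover have "real_of_int z / q - real_of_int z' / q = real_of_int k"
      using q k by (simp add: field_simps flip: of_int_diff of_int_mult of_int_add)
    ultimately show ?thesis by simp
  qed
  have bd: "\<bar>real_of_int z / q\<bar> \<le> 2 * L" if "z \<in> ?A" for z
  proof -
    have "0 \<le> L * q" using L q by simp
    then have "0 \<le> real_of_int z" using that by simp
    moreover have "real_of_int z \<le> 2 * L * q" using that by simp
    ultimately show ?thesis using q by (simp add: divide_le_eq)
  qed
  note sc = separated_count[of ?A "\<lambda>z i::unit. real_of_int z / q" "\<lambda>_. 2 * L", OF sep bd]
  show "finite ?A" by (rule sc(1)) (use L in auto)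
  have "real (card ?A) \<le> (\<Prod>i\<in>(UNIV::unit set). 2 * (2 * L) + 2)" by (rule sc(2)) (use L in auto)
  then show "real (card ?A) \<le> 6 * L" using L by simp
qed

text \<open>Let \<open>Box\<close> hold the integer vectors with entries up to a constant times
  \<open>1 / W i\<close>. The hypothesis \<open>dual\<close> makes their products with
  \<open>p\<close> distinct modulo \<open>q\<close>, whereas the residue \<open>s\<close> of an
  admissible \<open>z0\<close> makes \<open>s\<close> times each of these products nearly divisible
  by \<open>q\<close>. So \<open>bohr_count\<close> leaves few residues, and each residue comes from
  few \<open>z0\<close> and \<open>z\<close>.\<close>

lemma transference_count:
  fixes p :: "'d::finite \<Rightarrow> int" and q :: int and W :: "'d \<Rightarrow> real" and L :: real
  defines "d \<equiv> real CARD('d)"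
  assumes q: "q > 0" and L: "L \<ge> 1" and W: "\<And>i. W i > 0"
    and dual: "\<And>\<eta>. \<eta> \<noteq> (\<lambda>_. 0) \<Longrightarrow> (\<And>i. \<bar>of_int (\<eta> i)\<bar> * W i \<le> 1 / (8 * d)) \<Longrightarrow> \<not> q dvd (\<Sum>i\<in>UNIV. \<eta> i * p i)"
    and A: "\<And>z z0. (z, z0) \<in> A \<Longrightarrow> L * q \<le> real_of_int z0 \<and> real_of_int z0 < 2 * L * q
              \<and> (\<forall>i. \<bar>of_int (z i) - of_int z0 * of_int (p i) / of_int q\<bar> \<le> W i)"
  shows "finite A" and "real (card A) \<le> 24 * L * q * (\<Prod>i\<in>UNIV. 32 * d * W i)"
proof -
  have d: "d \<ge> 1" by (simp add: d_def Suc_leI)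
  define c where "c = 1 / (8 * d)"
  have c: "c > 0" "c \<le> 1" using d by (auto simp: c_def field_simps)
  \<comment> \<open>This rounding gives \<open>N i > c / W i\<close>, while two entries of the range
    \<open>{0..<N i}\<close> differ by at most \<open>N i - 1\<close>, hence by at most
    \<open>c / W i\<close>.\<close>
  define N where "N i = \<lfloor>c / W i\<rfloor> + 1" for i
  have N: "N i \<ge> 1" "real_of_int (N i) > c / W i" "(real_of_int (N i) - 1) * W i \<le> c" for i
  proof -
    have "c / W i \<ge> 0" using c W[of i] by simp
    then show "N i \<ge> 1" by (simp add: N_def)
    show "real_of_int (N i) > c / W i" by (simp add: N_def)
    have "real_of_int (N i) - 1 \<le> c / W i" by (simp add: N_def)
    then show "(real_of_int (N i) - 1) * W i \<le> c" using W[of i] by (simp add: pos_le_divide_eq)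
  qed
  define Box where "Box = PiE (UNIV :: 'd set) (\<lambda>i. {0..<N i})"
  have finBox: "finite Box" unfolding Box_def by (intro finite_PiE) auto
  have cardBox: "real (card Box) = (\<Prod>i\<in>UNIV. real_of_int (N i))"
    using N(1) by (simp add: Box_def card_PiE order_trans[OF zero_le_one])
  define h where "h k = (\<Sum>i\<in>UNIV. k i * p i)" for k :: "'d \<Rightarrow> int"
  have inj: "k = l" if kl: "k \<in> Box" "l \<in> Box" "q dvd h k - h l" for k l
  proof (rule ccontr)
    assume "k \<noteq> l"
    then have ne: "(\<lambda>i. k i - l i) \<noteq> (\<lambda>_. 0)" by (auto simp: fun_eq_iff)
    have "\<bar>real_of_int (k i - l i)\<bar> * W i \<le> 1 / (8 * d)" for i
    proof -
      have "0 \<le> k i" "k i < N i" "0 \<le> l i" "l i < N i" using kl by (auto simp: Box_def PiE_iff)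
      then have "\<bar>k i - l i\<bar> \<le> N i - 1" by linarith
      then have "\<bar>real_of_int (k i - l i)\<bar> \<le> real_of_int (N i) - 1" by linarith
      then have "\<bar>real_of_int (k i - l i)\<bar> * W i \<le> (real_of_int (N i) - 1) * W i"
        using W[of i] by (intro mult_right_mono) auto
      then show ?thesis using N(3)[of i] by (simp add: c_def)
    qed
    from dual[OF ne this] have "\<not> q dvd (\<Sum>i\<in>UNIV. (k i - l i) * p i)" by simp
    then show False using kl(3) by (simp add: h_def left_diff_distrib sum_subtractf)
  qed
  define K where "K = h ` Box"
  have cardK: "card K = card Box" unfolding K_def
    by (rule card_image) (auto intro!: inj_onI inj)
  define S where "S = (\<lambda>(z, z0). nat (z0 mod q)) ` A"
  have Sq: "S \<subseteq> {..<nat q}" using q by (auto simp: S_def)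
  have cosS: "1 / 2 \<le> cos (2 * pi * real s * real_of_int m / real (nat q))"
    if s: "s \<in> S" and m: "m \<in> K" for s m
  proof -
    obtain z z0 where z: "(z, z0) \<in> A" "s = nat (z0 mod q)" using s by (auto simp: S_def)
    obtain k where k: "k \<in> Box" "m = h k" using m by (auto simp: K_def)
    define e where "e i = of_int (z i) - of_int z0 * of_int (p i) / real_of_int q" for i
    have e: "\<bar>e i\<bar> \<le> W i" for i using A[OF z(1)] by (auto simp: e_def)
    define n where "n = (\<Sum>i\<in>UNIV. k i * z i) - (z0 div q) * h k"
    have "real s = real_of_int z0 - real_of_int q * real_of_int (z0 div q)"
      using q z(2) by (simp flip: of_int_mult of_int_diff add: minus_mult_div_eq_mod)
    then have "real s * real_of_int m / real_of_int q
        = real_of_int z0 * real_of_int (h k) / q - real_of_int (z0 div q) * real_of_int (h k)"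
      using q k(2) by (simp add: left_diff_distrib diff_divide_distrib)
    moreover have "(\<Sum>i\<in>UNIV. of_int (k i) * e i)
        = (\<Sum>i\<in>UNIV. of_int (k i) * of_int (z i)) - real_of_int z0 * real_of_int (h k) / q"
      by (simp add: e_def h_def right_diff_distrib sum_subtractf sum_distrib_left sum_divide_distrib mult_ac)
    \<comment> \<open>Passing from \<open>z0\<close> to its residue and from
      \<open>of_int z0 * p i / q\<close> to the nearby integers \<open>z i\<close> changes the phase
      by integers only, up to the errors \<open>e\<close>.\<close>
    ultimately have frac: "real s * real_of_int m / real_of_int q = real_of_int n - (\<Sum>i\<in>UNIV. of_int (k i) * e i)"
      by (simp add: n_def)
    have "2 * pi * real s * real_of_int m / real (nat q)
       = 2 * pi * (real s * real_of_int m / real_of_int q)" using q by simp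
    also have "\<dots> = 2 * pi * real_of_int n - 2 * pi * (\<Sum>i\<in>UNIV. of_int (k i) * e i)"
      unfolding frac by (rule right_diff_distrib)
    finally have eq: "2 * pi * real s * real_of_int m / real (nat q)
       = 2 * pi * real_of_int n - 2 * pi * (\<Sum>i\<in>UNIV. of_int (k i) * e i)" .
    have "\<bar>\<Sum>i\<in>UNIV. of_int (k i) * e i\<bar> \<le> (\<Sum>i\<in>UNIV. \<bar>of_int (k i) * e i\<bar>)" by (rule sum_abs)
    also have "\<dots> \<le> (\<Sum>i\<in>(UNIV :: 'd set). c)"
    proof (rule sum_mono)
      fix i
      have "0 \<le> k i" "k i < N i" using k(1) by (auto simp: Box_def PiE_iff)
      then have "real_of_int (k i) \<le> real_of_int (N i) - 1" "0 \<le> real_of_int (k i)" by linarith+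
      then have "real_of_int (k i) * \<bar>e i\<bar> \<le> (real_of_int (N i) - 1) * W i"
        using e[of i] by (intro mult_mono) auto
      then show "\<bar>of_int (k i) * e i\<bar> \<le> c" using N(3)[of i] \<open>0 \<le> real_of_int (k i)\<close>
        by (simp add: abs_mult)
    qed
    also have "\<dots> = 1 / 8" using d by (simp add: c_def d_def)
    finally have small: "\<bar>\<Sum>i\<in>UNIV. of_int (k i) * e i\<bar> \<le> 1 / 8" .
    define t where "t = 2 * pi * (\<Sum>i\<in>UNIV. of_int (k i) * e i)"
    \<comment> \<open>The error 1/8 is a phase of at most pi/4, which leaves the cosine above the
      1/2 asked for by \<open>bohr_count\<close>.\<close>
    have "\<bar>t\<bar> \<le> pi / 3" unfolding t_def using small pi_gt_zero by (simp add: abs_mult field_simps)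
    have "cos (2 * pi * real s * real_of_int m / real (nat q)) = cos (2 * pi * real_of_int n - t)"
      by (simp only: eq t_def)
    also have "\<dots> = cos t"
      by (simp add: cos_diff cos_int_2pin sin_int_2pin)
    also have "\<dots> = cos \<bar>t\<bar>" by simp
    also have "\<dots> \<ge> cos (pi / 3)" using \<open>\<bar>t\<bar> \<le> pi / 3\<close> pi_gt_zero by (intro cos_monotone_0_pi_le) auto
    finally show ?thesis by (simp add: cos_60)
  qed
  have "card S * card K \<le> 4 * nat q"
  proof (rule bohr_count)
    show "0 < nat q" using q by simp
    show "finite K" using finBox by (simp add: K_def)
    show "S \<subseteq> {..<nat q}" by (rule Sq)
    show "k = l" if "k \<in> K" "l \<in> K" "int (nat q) dvd k - l" for k l
      using that inj q by (auto simp: K_def)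
  qed (rule cosS)
  then have "real (card S * card K) \<le> real (4 * nat q)" by (rule of_nat_mono)
  then have SB: "real (card S) * real (card Box) \<le> 4 * q" using q cardK by simp
  define Z where "Z s = {z0. z0 mod q = int s \<and> L * q \<le> real_of_int z0 \<and> real_of_int z0 < 2 * L * q}" for s
  have Zf: "finite (Z s)" "real (card (Z s)) \<le> 6 * L" for s
    unfolding Z_def by (rule card_residue[OF q L])+
  define Y where "Y z0 = {z :: 'd \<Rightarrow> int. \<forall>i. \<bar>of_int (z i) - of_int z0 * of_int (p i) / of_int q\<bar> \<le> W i}" for z0 :: int
  define P where "P = (\<Prod>i\<in>UNIV. 2 * W i + 2)"
  have W0: "0 \<le> W i" for i using W[of i] by simp
  have Yf: "finite (Y z0)" "real (card (Y z0)) \<le> P" for z0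
    unfolding Y_def P_def by (rule card_int_box[OF W0])+
  have finS: "finite S" using Sq finite_subset by blast
  define U where "U = (\<Union>s\<in>S. Z s)"
  have finU: "finite U" using finS Zf by (simp add: U_def)
  have sub: "A \<subseteq> (\<lambda>(z0, z). (z, z0)) ` (Sigma U Y)"
  proof
    fix a assume a: "a \<in> A"
    obtain z z0 where zz: "a = (z, z0)" by (cases a)
    have "nat (z0 mod q) \<in> S" using a zz by (force simp: S_def)
    moreover have "z0 \<in> Z (nat (z0 mod q))" using A[of z z0] a zz q by (simp add: Z_def)
    ultimately have "z0 \<in> U" by (auto simp: U_def)
    moreover have "z \<in> Y z0" using A[of z z0] a zz by (simp add: Y_def)
    ultimately show "a \<in> (\<lambda>(z0, z). (z, z0)) ` (Sigma U Y)" using zz by (force simp: image_iff)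
  qed
  have finSig: "finite (Sigma U Y)" using finU Yf by (intro finite_SigmaI) auto
  show "finite A" by (rule finite_subset[OF sub]) (use finSig in simp)
  have P0: "P \<ge> 0" using W0 unfolding P_def by (intro prod_nonneg) (auto intro: add_nonneg_nonneg)
  have "card A \<le> card (Sigma U Y)"
    using surj_card_le[OF finSig sub] .
  also have "\<dots> = (\<Sum>z0\<in>U. card (Y z0))" using finU Yf by (intro card_SigmaI) auto
  finally have "real (card A) \<le> (\<Sum>z0\<in>U. real (card (Y z0)))"
    by (metis of_nat_le_iff of_nat_sum)
  also have "\<dots> \<le> (\<Sum>z0\<in>U. P)" by (intro sum_mono Yf)
  also have "\<dots> = real (card U) * P" by simp
  also have "real (card U) \<le> (\<Sum>s\<in>S. real (card (Z s)))"
    unfolding U_def using card_UN_le[OF finS, of Z] by (metis of_nat_le_iff of_nat_sum)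
  then have "real (card U) * P \<le> (\<Sum>s\<in>S. real (card (Z s))) * P" using P0 by (intro mult_right_mono)
  also have "\<dots> \<le> (\<Sum>s\<in>S. 6 * L) * P" using P0 by (intro mult_right_mono sum_mono Zf)
  also have "\<dots> = 6 * L * (real (card S) * P)" by simp
  also have "real (card S) * P \<le> 4 * q * (\<Prod>i\<in>UNIV. 32 * d * W i)"
  proof -
    \<comment> \<open>Note that \<open>32 * d = 4 / c\<close>. Wide coordinates are paid for by
      \<open>N i >= 1\<close>; in narrow ones, where \<open>W i < c\<close>, the inequality
      \<open>N i * W i > c\<close> does it. So the box of dual vectors cancels against the box of
      numerators.\<close>
    have "2 * W i + 2 \<le> real_of_int (N i) * (32 * d * W i)" for i
    proof (cases "W i \<ge> c")
      case True
      have "32 * d * W i = 4 * W i / c" by (simp add: c_def)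
      moreover have "2 \<le> 2 * W i / c" using True c by (simp add: field_simps)
      moreover have "2 * W i \<le> 2 * W i / c"
        using c W0[of i] by (simp add: le_divide_eq mult_left_le)
      ultimately have "2 * W i + 2 \<le> 1 * (32 * d * W i)" by simp
      also have "1 * (32 * d * W i) \<le> real_of_int (N i) * (32 * d * W i)"
        using N(1)[of i] d W0[of i] by (intro mult_right_mono) auto
      finally show ?thesis .
    next
      case False
      have "4 = (c / W i) * (32 * d * W i)" using W[of i] d by (simp add: c_def)
      also have "\<dots> \<le> real_of_int (N i) * (32 * d * W i)"
        using N(2)[of i] W0[of i] d by (intro mult_right_mono) auto
      finally show ?thesis using False c by linarith
    qed
    then have "P \<le> (\<Prod>i\<in>UNIV. real_of_int (N i) * (32 * d * W i))"
      unfolding P_def using W0 by (intro prod_mono) (auto intro: add_nonneg_nonneg)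
    also have "\<dots> = real (card Box) * (\<Prod>i\<in>UNIV. 32 * d * W i)"
      by (simp add: prod.distrib cardBox)
    finally have "real (card S) * P \<le> real (card S) * (real (card Box) * (\<Prod>i\<in>UNIV. 32 * d * W i))"
      by (intro mult_left_mono) auto
    also have "\<dots> = (real (card S) * real (card Box)) * (\<Prod>i\<in>UNIV. 32 * d * W i)" by simp
    also have "\<dots> \<le> 4 * q * (\<Prod>i\<in>UNIV. 32 * d * W i)"
      using SB W0 d by (intro mult_right_mono prod_nonneg) auto
    finally show ?thesis .
  qed
  then have "6 * L * (real (card S) * P) \<le> 6 * L * (4 * q * (\<Prod>i\<in>UNIV. 32 * d * W i))"
    using L by (intro mult_left_mono) auto
  finally show "real (card A) \<le> 24 * L * q * (\<Prod>i\<in>UNIV. 32 * d * W i)" by (simp add: mult_ac)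
qed

section \<open>Integer linear forms and elementary estimates\<close>

type_synonym 'd point = "('d \<Rightarrow> int) \<times> int"

definition lin :: "('d::finite \<Rightarrow> int) \<Rightarrow> int \<Rightarrow> 'd point \<Rightarrow> int" where
  "lin \<xi> \<xi>0 v = (\<Sum>i\<in>UNIV. \<xi> i * fst v i) + \<xi>0 * snd v"

text \<open>This compares the integer value of a form at \<open>v\<close> with its value on the line
  spanned by \<open>(x, 1)\<close>, so that bounds on residues become statements about
  integers.\<close>

lemma lin_deviation:
  fixes x :: "'d::finite \<Rightarrow> real"
  shows "(\<Sum>i\<in>UNIV. of_int (\<xi> i) * (of_int (fst v i) - of_int (snd v) * x i))
    = of_int (lin \<xi> \<xi>0 v) - of_int (snd v) * ((\<Sum>i\<in>UNIV. of_int (\<xi> i) * x i) + of_int \<xi>0)"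
  by (simp add: lin_def right_diff_distrib sum_subtractf sum_distrib_left distrib_left mult_ac)

text \<open>When the hyperplane passes through \<open>v\<close>, the correction term for
  \<open>x = fst v / snd v\<close> vanishes. The sum is then an integer: if it is small,
  \<open>z\<close> lies in the hyperplane, and if \<open>z\<close> lies outside, it is at least 1 in
  absolute value.\<close>

lemma lin_deviation_point:
  assumes "snd v \<noteq> 0" "lin \<xi> \<xi>0 v = 0"
  shows "(\<Sum>i\<in>UNIV. of_int (\<xi> i) * (of_int (fst z i) - of_int (snd z) * of_int (fst v i) / of_int (snd v)))
    = real_of_int (lin \<xi> \<xi>0 z)"
proof -
  have "real_of_int (lin \<xi> \<xi>0 v) = 0" using assms by simp
  then have "(\<Sum>i\<in>UNIV. of_int (\<xi> i) * (of_int (fst v i) / real_of_int (snd v))) + of_int \<xi>0 = 0"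
    using assms(1) by (simp add: lin_def flip: sum_divide_distrib) (simp add: field_simps)
  then show ?thesis
    using lin_deviation[of \<xi> z "\<lambda>i. of_int (fst v i) / of_int (snd v)" \<xi>0] by simp
qed

text \<open>The supremum of the radii need not be attained, but some radius exceeds half of it. The
  counting lemmas compare the tube with this radius to all the others.\<close>

lemma maximal_radius:
  fixes P :: "'a \<Rightarrow> real \<Rightarrow> bool"
  assumes "P a0 r0" "\<And>a r. P a r \<Longrightarrow> 0 < r \<and> r \<le> B"
  shows "\<exists>a1 r1. P a1 r1 \<and> (\<forall>a r. P a r \<longrightarrow> r \<le> 2 * r1)"
proof -
  define X where "X = {r. \<exists>a. P a r}"
  have X: "r0 \<in> X" "bdd_above X" using assms by (auto simp: X_def intro!: bdd_aboveI[of _ B])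
  have "0 < r0" using assms by blast
  then have "0 < Sup X" using cSup_upper[OF X] by linarith
  then have "\<exists>r\<in>X. Sup X / 2 < r" using X by (intro less_cSupD) auto
  then obtain r1 where r1: "r1 \<in> X" "Sup X / 2 < r1" by blast
  then obtain a1 where "P a1 r1" by (auto simp: X_def)
  moreover have "r \<le> 2 * r1" if "P a r" for a r
  proof -
    have "r \<le> Sup X" using that X(2) by (intro cSup_upper) (auto simp: X_def)
    then show ?thesis using r1 by linarith
  qed
  ultimately show ?thesis by blast
qed

lemma ex_max_abs:
  fixes c :: "'n::finite \<Rightarrow> real"
  shows "\<exists>i0. \<forall>i. \<bar>c i\<bar> \<le> \<bar>c i0\<bar>"
proof -
  have "Max (range (\<lambda>i. \<bar>c i\<bar>)) \<in> range (\<lambda>i. \<bar>c i\<bar>)" by (rule Max_in) auto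
  then obtain i0 where "Max (range (\<lambda>i. \<bar>c i\<bar>)) = \<bar>c i0\<bar>" by (rule imageE)
  moreover have "\<bar>c i\<bar> \<le> Max (range (\<lambda>i. \<bar>c i\<bar>))" for i by (rule Max_ge) auto
  ultimately show ?thesis by metis
qed

lemma dyadic_index:
  fixes q t :: real
  assumes "0 < q" "q \<le> t"
  shows "\<exists>a. 2 ^ a * q \<le> t \<and> t < 2 * 2 ^ a * q"
proof -
  define a where "a = nat \<lfloor>log 2 (t / q)\<rfloor>"
  have tq: "t / q \<ge> 1" using assms by simp
  then have l0: "log 2 (t / q) \<ge> 0" by simp
  have "real a \<le> log 2 (t / q)" "log 2 (t / q) < real a + 1"
    using l0 unfolding a_def by linarith+
  then have "2 powr real a \<le> t / q" "t / q < 2 powr (real a + 1)"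
    using tq by (auto simp: le_log_iff log_less_iff)
  then have "2 ^ a \<le> t / q" "t / q < 2 * 2 ^ a"
    by (auto simp: powr_realpow powr_add)
  then show ?thesis using assms by (auto simp: field_simps)
qed

text \<open>Since \<open>2 powr \<kappa> >= 1 + \<kappa> * ln 2\<close>, the ratio stays below 1 by
  at least \<open>\<kappa> / 4\<close>. Two such sums produce the term
  \<open>\<epsilon> / \<kappa>^2\<close>, hence the square root of \<epsilon> in the
  theorem.\<close>

lemma geometric_powr_le:
  fixes \<kappa> :: real
  assumes "0 < \<kappa>" "\<kappa> \<le> 1"
  shows "(\<Sum>a\<le>N. (2 powr (- \<kappa>)) ^ a) \<le> 4 / \<kappa>"
proof -
  define x where "x = 2 powr (- \<kappa>)"
  have l: "1 / 2 \<le> ln (2::real)" "ln (2::real) \<le> 1" using ln2_ge_two_thirds ln_2_less_1 by auto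
  have "1 + \<kappa> * ln 2 \<le> 2 powr \<kappa>"
    using exp_ge_add_one_self[of "\<kappa> * ln 2"] by (simp add: powr_def)
  moreover have "0 < 1 + \<kappa> * ln 2" using assms l by (simp add: add_pos_nonneg)
  ultimately have "x \<le> 1 / (1 + \<kappa> * ln 2)"
    unfolding x_def powr_minus_divide by (intro divide_left_mono) auto
  moreover have "\<kappa> / 4 \<le> 1 - 1 / (1 + \<kappa> * ln 2)"
  proof -
    have "\<kappa> * ln 2 \<le> 1 * 1" "\<kappa> * (1 / 2) \<le> \<kappa> * ln 2" using assms l by (intro mult_mono; simp)+
    then have "1 + \<kappa> * ln 2 \<le> 2" "\<kappa> / 2 \<le> \<kappa> * ln 2" by simp_all
    have "1 - 1 / (1 + \<kappa> * ln 2) = (\<kappa> * ln 2) / (1 + \<kappa> * ln 2)"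
      using \<open>0 < 1 + \<kappa> * ln 2\<close> by (simp add: field_simps)
    also have "\<dots> \<ge> (\<kappa> / 2) / 2"
      using \<open>1 + \<kappa> * ln 2 \<le> 2\<close> \<open>\<kappa> / 2 \<le> \<kappa> * ln 2\<close> \<open>0 < 1 + \<kappa> * ln 2\<close> assms
      by (intro frac_le) auto
    finally show ?thesis by simp
  qed
  ultimately have x: "\<kappa> / 4 \<le> 1 - x" by linarith
  then have "x < 1" "x \<ge> 0" using assms by (auto simp: x_def)
  have "(\<Sum>a\<le>N. x ^ a) = (1 - x ^ Suc N) / (1 - x)"
    using \<open>x < 1\<close> by (simp add: sum_gp0)
  also have "\<dots> \<le> 1 / (\<kappa> / 4)"
    using x assms \<open>x \<ge> 0\<close> by (intro frac_le) auto
  finally show ?thesis by (simp add: x_def)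
qed

lemma power_two_powr: "((2::real) ^ a) powr t = (2 powr t) ^ a"
  by (simp add: powr_powr mult.commute flip: powr_realpow)

section \<open>Sets of Hausdorff measure zero\<close>

text \<open>The vanishing of the Hausdorff measure in epsilon-delta form, free of infima and
  suprema, so that covers can be constructed and combined directly.\<close>

definition null_cover :: "real \<Rightarrow> 'a::metric_space set \<Rightarrow> bool" where
  "null_cover s A \<longleftrightarrow> (\<forall>\<delta>>0. \<forall>\<eta>>0. \<exists>U :: nat \<Rightarrow> 'a set. A \<subseteq> (\<Union>i. U i)
     \<and> (\<forall>i. bounded (U i) \<and> diameter (U i) \<le> \<delta>) \<and> (\<Sum>i. hausdorff_gauge s (U i)) \<le> ennreal \<eta>)"

lemma hausdorff_measure_null:
  assumes "null_cover s A"
  shows "hausdorff_measure s A = 0"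
proof -
  have "hausdorff_content s \<delta> A \<le> 0" if d: "\<delta> > 0" for \<delta>
  proof (rule ennreal_le_epsilon)
    fix e :: real assume "0 < e"
    then obtain U :: "nat \<Rightarrow> 'a set" where "A \<subseteq> (\<Union>i. U i)" "\<forall>i. bounded (U i) \<and> diameter (U i) \<le> \<delta>"
      "(\<Sum>i. hausdorff_gauge s (U i)) \<le> ennreal e"
      using assms d unfolding null_cover_def by blast
    then have "hausdorff_content s \<delta> A \<le> ennreal e"
      unfolding hausdorff_content_def by (intro INF_lower2[of U]) auto
    then show "hausdorff_content s \<delta> A \<le> 0 + ennreal e" by simp
  qed
  then have "hausdorff_measure s A \<le> 0"
    unfolding hausdorff_measure_def by (intro SUP_least) auto
  then show ?thesis by simp
qed

lemma null_cover_subset: 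
  assumes "null_cover s B" "A \<subseteq> B"
  shows "null_cover s A"
  unfolding null_cover_def
proof (intro allI impI)
  fix \<delta> \<eta> :: real assume "\<delta> > 0" "\<eta> > 0"
  from assms(1)[unfolded null_cover_def, rule_format, OF this]
  obtain U :: "nat \<Rightarrow> 'a set" where "B \<subseteq> (\<Union>i. U i) \<and> (\<forall>i. bounded (U i) \<and> diameter (U i) \<le> \<delta>)
     \<and> (\<Sum>i. hausdorff_gauge s (U i)) \<le> ennreal \<eta>" by (elim exE)
  then show "\<exists>U :: nat \<Rightarrow> 'a set. A \<subseteq> (\<Union>i. U i) \<and> (\<forall>i. bounded (U i) \<and> diameter (U i) \<le> \<delta>)
     \<and> (\<Sum>i. hausdorff_gauge s (U i)) \<le> ennreal \<eta>" using assms(2) by (intro exI[of _ U]) auto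
qed

text \<open>The set with index \<open>n\<close> receives the share \<open>\<eta> / 2^(n+1)\<close>,
  and \<open>prod_decode\<close> merges the covers into one sequence.\<close>

lemma null_cover_UN:
  assumes "\<And>n :: nat. null_cover s (A n)"
  shows "null_cover s (\<Union>n. A n)"
  unfolding null_cover_def
proof (intro allI impI)
  fix \<delta> \<eta> :: real assume d: "\<delta> > 0" and e: "\<eta> > 0"
  have "\<forall>n. \<exists>U :: nat \<Rightarrow> 'a set. A n \<subseteq> (\<Union>i. U i) \<and> (\<forall>i. bounded (U i) \<and> diameter (U i) \<le> \<delta>)
      \<and> (\<Sum>i. hausdorff_gauge s (U i)) \<le> ennreal (\<eta> * (1 / 2) ^ Suc n)"
  proof
    fix n
    have "\<eta> * (1 / 2) ^ Suc n > 0" using e by simp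
    from assms[unfolded null_cover_def, rule_format, OF d this]
    show "\<exists>U :: nat \<Rightarrow> 'a set. A n \<subseteq> (\<Union>i. U i) \<and> (\<forall>i. bounded (U i) \<and> diameter (U i) \<le> \<delta>)
      \<and> (\<Sum>i. hausdorff_gauge s (U i)) \<le> ennreal (\<eta> * (1 / 2) ^ Suc n)" .
  qed
  from choice[OF this] obtain U :: "nat \<Rightarrow> nat \<Rightarrow> 'a set" where UU: "\<forall>n. A n \<subseteq> (\<Union>i. U n i)
     \<and> (\<forall>i. bounded (U n i) \<and> diameter (U n i) \<le> \<delta>)
     \<and> (\<Sum>i. hausdorff_gauge s (U n i)) \<le> ennreal (\<eta> * (1 / 2) ^ Suc n)" by (elim exE)
  then have U: "A n \<subseteq> (\<Union>i. U n i)" "bounded (U n i) \<and> diameter (U n i) \<le> \<delta>"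
    "(\<Sum>i. hausdorff_gauge s (U n i)) \<le> ennreal (\<eta> * (1 / 2) ^ Suc n)" for n i by auto
  define V where "V m = (case prod_decode m of (n, i) \<Rightarrow> U n i)" for m
  have "(\<Union>n. A n) \<subseteq> (\<Union>m. V m)"
  proof
    fix x assume "x \<in> (\<Union>n. A n)"
    then obtain n i where "x \<in> U n i" using U(1) by blast
    then have "x \<in> V (prod_encode (n, i))" by (simp add: V_def)
    then show "x \<in> (\<Union>m. V m)" by blast
  qed
  moreover have "\<forall>m. bounded (V m) \<and> diameter (V m) \<le> \<delta>" using U(2) by (auto simp: V_def split: prod.split)
  moreover have "(\<Sum>m. hausdorff_gauge s (V m)) \<le> ennreal \<eta>"
  proof -
    have "(\<Sum>m. hausdorff_gauge s (V m)) = (\<Sum>m. (\<lambda>(n, i). hausdorff_gauge s (U n i)) (prod_decode m))"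
      by (intro suminf_cong) (simp add: V_def split: prod.split)
    also have "\<dots> = (\<Sum>n. \<Sum>i. hausdorff_gauge s (U n i))"
      by (subst suminf_ennreal_2dimen[where g = "\<lambda>n. \<Sum>i. hausdorff_gauge s (U n i)"]) (auto simp: comp_def)
    also have "\<dots> \<le> (\<Sum>n. ennreal (\<eta> * (1 / 2) ^ Suc n))" by (intro suminf_le U(3)) auto
    also have "\<dots> = ennreal (\<Sum>n. \<eta> * (1 / 2) ^ Suc n)"
      using e power_half_series by (intro suminf_ennreal2) (auto intro: summable_mult sums_summable)
    also have "(\<Sum>n. \<eta> * (1 / 2) ^ Suc n) = \<eta>"
      using sums_mult[OF power_half_series, of \<eta>] by (simp add: sums_iff)
    finally show ?thesis .
  qed
  ultimately show "\<exists>U :: nat \<Rightarrow> 'a set. (\<Union>n. A n) \<subseteq> (\<Union>i. U i) \<and> (\<forall>i. bounded (U i) \<and> diameter (U i) \<le> \<delta>)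
      \<and> (\<Sum>i. hausdorff_gauge s (U i)) \<le> ennreal \<eta>" by (intro exI[of _ V]) auto
qed

text \<open>Covers are here indexed by a subset of any countable type, and only finite partial sums
  are bounded. This suits families such as pairs of a lattice point and a cell.\<close>

lemma null_coverI:
  fixes A :: "'a::metric_space set"
  assumes s: "s > 0"
    and cov: "\<And>\<delta> \<eta>. \<delta> > 0 \<Longrightarrow> \<eta> > 0 \<Longrightarrow> \<exists>(J :: 'j::countable set) (U :: 'j \<Rightarrow> 'a set). A \<subseteq> (\<Union>j\<in>J. U j)
       \<and> (\<forall>j\<in>J. bounded (U j) \<and> diameter (U j) \<le> \<delta>)
       \<and> (\<forall>F. finite F \<and> F \<subseteq> J \<longrightarrow> (\<Sum>j\<in>F. diameter (U j) powr s) \<le> \<eta>)"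
  shows "null_cover s A"
  unfolding null_cover_def
proof (intro allI impI)
  fix \<delta> \<eta> :: real assume d: "\<delta> > 0" and e: "\<eta> > 0"
  from cov[OF this] obtain J :: "'j set" and U :: "'j \<Rightarrow> 'a set" where
    JU: "A \<subseteq> (\<Union>j\<in>J. U j) \<and> (\<forall>j\<in>J. bounded (U j) \<and> diameter (U j) \<le> \<delta>)
       \<and> (\<forall>F. finite F \<and> F \<subseteq> J \<longrightarrow> (\<Sum>j\<in>F. diameter (U j) powr s) \<le> \<eta>)" by (elim exE)
  then have U: "A \<subseteq> (\<Union>j\<in>J. U j)" "\<And>j. j \<in> J \<Longrightarrow> bounded (U j) \<and> diameter (U j) \<le> \<delta>"
    "\<And>F. finite F \<Longrightarrow> F \<subseteq> J \<Longrightarrow> (\<Sum>j\<in>F. diameter (U j) powr s) \<le> \<eta>" by auto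
  \<comment> \<open>Numbers that encode no index get the empty set, whose gauge is 0.\<close>
  define V where "V n = (if n \<in> to_nat ` J then U (from_nat n) else {})" for n
  have "A \<subseteq> (\<Union>n. V n)"
  proof
    fix x assume "x \<in> A"
    then obtain j where "j \<in> J" "x \<in> U j" using U(1) by blast
    then have "x \<in> V (to_nat j)" by (simp add: V_def)
    then show "x \<in> (\<Union>n. V n)" by blast
  qed
  moreover have "\<forall>n. bounded (V n) \<and> diameter (V n) \<le> \<delta>"
    using U(2) d by (auto simp: V_def)
  moreover have "(\<Sum>n. hausdorff_gauge s (V n)) \<le> ennreal \<eta>"
  proof (rule suminf_le_const)
    fix n
    define F where "F = {j \<in> J. to_nat j < n}"
    have inj: "inj_on to_nat F" by (rule inj_on_subset[OF inj_to_nat]) auto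
    have sub: "to_nat ` F \<subseteq> {..<n}" by (auto simp: F_def)
    have finF: "finite F" using finite_imageD[OF finite_subset[OF sub] inj] by simp
    have "(\<Sum>i<n. hausdorff_gauge s (V i)) = (\<Sum>i\<in>to_nat ` F. hausdorff_gauge s (V i))"
      by (rule sum.mono_neutral_right) (use sub in \<open>auto simp: V_def F_def hausdorff_gauge_def\<close>)
    also have "\<dots> = (\<Sum>j\<in>F. hausdorff_gauge s (V (to_nat j)))" by (simp add: sum.reindex[OF inj])
    also have "\<dots> \<le> (\<Sum>j\<in>F. ennreal (diameter (U j) powr s))"
      using s by (intro sum_mono) (auto simp: V_def F_def hausdorff_gauge_def)
    also have "\<dots> = ennreal (\<Sum>j\<in>F. diameter (U j) powr s)" by (intro sum_ennreal) auto
    also have "\<dots> \<le> ennreal \<eta>" using finF by (intro ennreal_leI U(3)) (auto simp: F_def)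
    finally show "(\<Sum>i<n. hausdorff_gauge s (V i)) \<le> ennreal \<eta>" .
  qed auto
  ultimately show "\<exists>U :: nat \<Rightarrow> 'a set. A \<subseteq> (\<Union>i. U i) \<and> (\<forall>i. bounded (U i) \<and> diameter (U i) \<le> \<delta>)
      \<and> (\<Sum>i. hausdorff_gauge s (U i)) \<le> ennreal \<eta>" by (intro exI[of _ V]) auto
qed

section \<open>Grid cells and hyperplanes\<close>

definition grid_cell :: "('d::finite \<Rightarrow> real) \<Rightarrow> real \<Rightarrow> ('d \<Rightarrow> int) \<Rightarrow> (real ^ 'd) set" where
  "grid_cell t l k = {x. \<forall>i. \<lfloor>(x $ i - t i) / l\<rfloor> = k i}"

lemma grid_cell:
  fixes t :: "'d::finite \<Rightarrow> real"
  assumes l: "l > 0"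
  shows "bounded (grid_cell t l k)" "diameter (grid_cell t l k) \<le> real CARD('d) * l"
proof -
  have dist: "norm (x - y) \<le> real CARD('d) * l" if "x \<in> grid_cell t l k" "y \<in> grid_cell t l k" for x y
  proof -
    have "norm (x - y) \<le> (\<Sum>i\<in>UNIV. \<bar>(x - y) $ i\<bar>)" by (rule norm_le_l1_cart)
    also have "\<dots> \<le> (\<Sum>i\<in>(UNIV::'d set). l)"
    proof (rule sum_mono)
      fix i
      have "\<lfloor>(x $ i - t i) / l\<rfloor> = \<lfloor>(y $ i - t i) / l\<rfloor>" using that by (simp add: grid_cell_def)
      then have "\<bar>(x $ i - t i) / l - (y $ i - t i) / l\<bar> < 1" by linarith
      moreover have "(x $ i - t i) / l - (y $ i - t i) / l = (x $ i - y $ i) / l"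
        by (simp add: diff_divide_distrib)
      ultimately have "\<bar>x $ i - y $ i\<bar> < l" using l by (simp add: abs_divide)
      then show "\<bar>(x - y) $ i\<bar> \<le> l" by simp
    qed
    finally show ?thesis by simp
  qed
  show "bounded (grid_cell t l k)"
    unfolding bounded_two_points using dist by (auto simp: dist_norm)
  show "diameter (grid_cell t l k) \<le> real CARD('d) * l"
    using dist l by (intro diameter_le) auto
qed

lemma diameter_grid_cell_powr:
  fixes t :: "'d::finite \<Rightarrow> real"
  assumes "l > 0" "s > 0"
  shows "diameter (grid_cell t l k) powr s \<le> (real CARD('d) * l) powr s"
  using grid_cell[OF assms(1), of t k] assms(2) diameter_ge_0[OF grid_cell(1)[OF assms(1)]]
  by (intro powr_mono2) auto

text \<open>In dimension \<open>n\<close>, \<open>slab_count\<close> shows that a bounded piece of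
  the hyperplane meets \<open>O(M^(n-1))\<close> cells of side \<open>1 / M\<close>. Their sum is
  \<open>O(M^(n-1-s))\<close>, which tends to 0.\<close>

lemma null_cover_hyperplane:
  fixes \<xi> :: "'d::finite \<Rightarrow> real"
  assumes xi: "\<xi> \<noteq> (\<lambda>_. 0)" and s: "s > real CARD('d) - 1"
  shows "null_cover s {x :: real ^ 'd. (\<Sum>i\<in>UNIV. \<xi> i * x $ i) + c = 0}"
proof -
  let ?n = "CARD('d)"
  let ?H = "{x :: real ^ 'd. (\<Sum>i\<in>UNIV. \<xi> i * x $ i) + c = 0}"
  have n: "real ?n \<ge> 1" by (simp add: Suc_leI)
  have s0: "s > 0" using s n by linarith
  define B where "B R = {x \<in> ?H. \<forall>i. \<bar>x $ i\<bar> \<le> real R}" for R :: nat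
  obtain i0 where i0: "\<And>i. \<bar>\<xi> i\<bar> \<le> \<bar>\<xi> i0\<bar>" using ex_max_abs by blast
  obtain j where "\<xi> j \<noteq> 0" using xi by auto
  then have x0: "\<xi> i0 \<noteq> 0" using i0[of j] by auto
  have "null_cover s (B R)" for R
  proof (rule null_coverI[OF s0])
    fix \<delta> \<eta> :: real assume d: "\<delta> > 0" and e: "\<eta> > 0"
    define C where "C = (4 * (2 * real ?n) + 2) * (4 * real ?n * (2 * real R + 2) + 2) ^ (?n - 1) * real ?n powr s"
    have "((\<lambda>M. C * real M powr (real ?n - 1 - s)) \<longlongrightarrow> C * 0) sequentially"
      using s by (intro tendsto_mult_left tendsto_neg_powr filterlim_real_sequentially) auto
    then have ev1: "\<forall>\<^sub>F M in sequentially. C * real M powr (real ?n - 1 - s) < \<eta>"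
      using e by (intro order_tendstoD) auto
    have "((\<lambda>M. real ?n * inverse (real M)) \<longlongrightarrow> real ?n * 0) sequentially"
      by (intro tendsto_mult_left lim_inverse_n)
    then have ev2: "\<forall>\<^sub>F M in sequentially. real ?n * inverse (real M) < \<delta>"
      using d by (intro order_tendstoD) auto
    have "\<forall>\<^sub>F M in sequentially. M \<ge> 1 \<and> C * real M powr (real ?n - 1 - s) < \<eta> \<and> real ?n * inverse (real M) < \<delta>"
      using ev1 ev2 eventually_ge_at_top[of 1] by eventually_elim auto
    then obtain M where M: "M \<ge> 1" "C * real M powr (real ?n - 1 - s) < \<eta>" "real ?n * inverse (real M) < \<delta>"
      using eventually_happens'[OF sequentially_bot] by blast
    define l where "l = inverse (real M)"
    have l: "l > 0" using M by (simp add: l_def)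
    define cell where "cell x i = \<lfloor>(x $ i - 0) / l\<rfloor>" for x :: "real ^ 'd" and i
    have cl: "\<bar>of_int (cell x i) - real M * x $ i\<bar> \<le> 1" for x i
      using M by (simp add: cell_def l_def mult.commute divide_inverse) linarith
    define J where "J = cell ` B R"
    have card: "finite J \<and> real (card J) * (real ?n * l) powr s \<le> \<eta>"
    proof (cases "B R = {}")
      case True
      then show ?thesis using e by (simp add: J_def)
    next
      case False
      \<comment> \<open>Indices relative to the cell of one point \<open>x1\<close> of the piece
        eliminate the constant \<open>c\<close>. Rounding errors then leave a slab whose width does
        not depend on \<open>M\<close>.\<close>
      then obtain x1 where x1: "x1 \<in> B R" by blast
      define f where "f k i = real_of_int (k i - cell x1 i)" for k :: "'d \<Rightarrow> int" and i
      have sep: "\<exists>i. 1 \<le> \<bar>f a i - f b i\<bar>" if ab: "a \<in> J" "b \<in> J" "a \<noteq> b" for a b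
      proof -
        obtain i where "a i \<noteq> b i" using ab(3) by blast
        then have "1 \<le> \<bar>a i - b i\<bar>" by linarith
        then have "1 \<le> \<bar>real_of_int (a i) - real_of_int (b i)\<bar>" by linarith
        then show ?thesis by (intro exI[of _ i]) (simp add: f_def)
      qed
      have bound: "\<bar>f k i\<bar> \<le> (2 * real R + 2) * real M" if "k \<in> J" for k i
      proof -
        obtain x where x: "x \<in> B R" "k = cell x" using \<open>k \<in> J\<close> by (auto simp: J_def)
        have "\<bar>x $ i\<bar> \<le> real R" "\<bar>x1 $ i\<bar> \<le> real R" using x(1) x1 by (auto simp: B_def)
        then have "real M * \<bar>x $ i\<bar> \<le> real M * real R" "real M * \<bar>x1 $ i\<bar> \<le> real M * real R"
          by (auto intro: mult_left_mono)
        then have "\<bar>real M * x $ i\<bar> \<le> real M * real R" "\<bar>real M * x1 $ i\<bar> \<le> real M * real R"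
          by (simp_all add: abs_mult)
        then have "\<bar>f k i\<bar> \<le> 2 * (real M * real R) + 2 * 1"
          using cl[of x i] cl[of x1 i] unfolding f_def x(2) of_int_diff by linarith
        also have "\<dots> \<le> 2 * (real M * real R) + 2 * real M" using M by simp
        finally show ?thesis by (simp add: algebra_simps)
      qed
      have slab: "\<bar>\<Sum>i\<in>UNIV. \<xi> i * f k i\<bar> \<le> (2 * real ?n) * \<bar>\<xi> i0\<bar>" if "k \<in> J" for k
      proof -
        obtain x where x: "x \<in> B R" "k = cell x" using \<open>k \<in> J\<close> by (auto simp: J_def)
        have "(\<Sum>i\<in>UNIV. \<xi> i * x $ i) = (\<Sum>i\<in>UNIV. \<xi> i * x1 $ i)" using x(1) x1 by (simp add: B_def)
        then have "(\<Sum>i\<in>UNIV. \<xi> i * (real M * x $ i)) = (\<Sum>i\<in>UNIV. \<xi> i * (real M * x1 $ i))"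
          by (simp add: mult.left_commute flip: sum_distrib_left)
        then have "(\<Sum>i\<in>UNIV. \<xi> i * f k i) = (\<Sum>i\<in>UNIV. \<xi> i * ((of_int (cell x i) - real M * x $ i) - (of_int (cell x1 i) - real M * x1 $ i)))"
          by (simp add: f_def x(2) right_diff_distrib sum_subtractf)
        also have "\<bar>\<dots>\<bar> \<le> (\<Sum>i\<in>UNIV. \<bar>\<xi> i * ((of_int (cell x i) - real M * x $ i) - (of_int (cell x1 i) - real M * x1 $ i))\<bar>)"
          by (rule sum_abs)
        also have "\<dots> \<le> (\<Sum>i\<in>(UNIV :: 'd set). \<bar>\<xi> i0\<bar> * 2)"
        proof (rule sum_mono)
          fix i
          have "\<bar>(of_int (cell x i) - real M * x $ i) - (of_int (cell x1 i) - real M * x1 $ i)\<bar> \<le> 2"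
            using cl[of x i] cl[of x1 i] by linarith
          then show "\<bar>\<xi> i * ((of_int (cell x i) - real M * x $ i) - (of_int (cell x1 i) - real M * x1 $ i))\<bar> \<le> \<bar>\<xi> i0\<bar> * 2"
            unfolding abs_mult using i0[of i] by (intro mult_mono) auto
        qed
        finally show ?thesis by simp
      qed
      note sc = slab_count[of J f "(2 * real R + 2) * real M" "2 * real ?n" \<xi> i0, OF sep bound _ _ x0 i0 slab]
      have "finite J" by (rule sc(1)) auto
      have "real (card J) \<le> (4 * (2 * real ?n) + 2) * (4 * real ?n * ((2 * real R + 2) * real M) + 2) ^ (?n - 1)"
        by (rule sc(2)) auto
      also have "\<dots> \<le> (4 * (2 * real ?n) + 2) * ((4 * real ?n * (2 * real R + 2) + 2) * real M) ^ (?n - 1)"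
        using M by (intro mult_left_mono power_mono) (auto simp: algebra_simps)
      finally have "real (card J) * (real ?n * l) powr s
         \<le> (4 * (2 * real ?n) + 2) * ((4 * real ?n * (2 * real R + 2) + 2) * real M) ^ (?n - 1) * (real ?n * l) powr s"
        by (intro mult_right_mono) auto
      also have "\<dots> = C * (real M ^ (?n - 1) * l powr s)"
        using l by (simp add: C_def power_mult_distrib powr_mult)
      also have "real M ^ (?n - 1) * l powr s = real M powr (real ?n - 1 - s)"
      proof -
        have "real M ^ (?n - 1) = real M powr (real ?n - 1)"
          using M by (simp add: powr_realpow[symmetric] of_nat_diff Suc_leI)
        moreover have "l powr s = real M powr (- s)" using M by (simp add: l_def powr_minus inverse_powr)
        ultimately show ?thesis by (simp flip: powr_add)
      qed
      finally show ?thesis using M \<open>finite J\<close> by simp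
    qed
    show "\<exists>(J :: ('d \<Rightarrow> int) set) U. B R \<subseteq> (\<Union>j\<in>J. U j) \<and> (\<forall>j\<in>J. bounded (U j) \<and> diameter (U j) \<le> \<delta>)
       \<and> (\<forall>F. finite F \<and> F \<subseteq> J \<longrightarrow> (\<Sum>j\<in>F. diameter (U j) powr s) \<le> \<eta>)"
    proof (intro exI[of _ J] exI[of _ "grid_cell (\<lambda>_. 0) l"] conjI allI impI ballI)
      show "B R \<subseteq> (\<Union>j\<in>J. grid_cell (\<lambda>_. 0) l j)"
      proof
        fix x assume "x \<in> B R"
        then have "cell x \<in> J" by (simp add: J_def)
        moreover have "x \<in> grid_cell (\<lambda>_. 0) l (cell x)" by (simp add: grid_cell_def cell_def)
        ultimately show "x \<in> (\<Union>j\<in>J. grid_cell (\<lambda>_. 0) l j)" by blast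
      qed
      fix j
      show "bounded (grid_cell (\<lambda>_. 0 :: real) l j :: (real ^ 'd) set)" by (rule grid_cell[OF l])
      show "diameter (grid_cell (\<lambda>_. 0 :: real) l j :: (real ^ 'd) set) \<le> \<delta>"
        using grid_cell(2)[OF l, of "\<lambda>_. 0" j] M(3) by (simp add: l_def)
    next
      fix F assume F: "finite F \<and> F \<subseteq> J"
      have "(\<Sum>j\<in>F. diameter (grid_cell (\<lambda>_. 0 :: real) l j :: (real ^ 'd) set) powr s) \<le> (\<Sum>j\<in>F. (real ?n * l) powr s)"
        by (intro sum_mono diameter_grid_cell_powr l s0)
      also have "\<dots> = real (card F) * (real ?n * l) powr s" by simp
      also have "\<dots> \<le> real (card J) * (real ?n * l) powr s"
        using F card by (intro mult_right_mono) (auto intro: card_mono)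
      finally show "(\<Sum>j\<in>F. diameter (grid_cell (\<lambda>_. 0 :: real) l j :: (real ^ 'd) set) powr s) \<le> \<eta>"
        using card by linarith
    qed
  qed
  then have "null_cover s (\<Union>R. B R)" by (rule null_cover_UN)
  moreover have "?H \<subseteq> (\<Union>R. B R)"
  proof
    fix x assume x: "x \<in> ?H"
    obtain R where R: "norm x \<le> real R" using real_arch_simple by blast
    have "\<bar>x $ i\<bar> \<le> real R" for i using component_le_norm_cart[of x i] R by linarith
    then have "x \<in> B R" using x by (simp add: B_def)
    then show "x \<in> (\<Union>R. B R)" by blast
  qed
  ultimately show ?thesis by (rule null_cover_subset)
qed

lemma null_cover_countable:
  fixes A :: "'j::countable \<Rightarrow> 'a::metric_space set"
  assumes "\<And>j. null_cover s (A j)"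
  shows "null_cover s (\<Union>j. A j)"
proof -
  have "null_cover s (\<Union>n :: nat. A (from_nat n))" by (rule null_cover_UN) (rule assms)
  moreover have "(\<Union>j. A j) \<subseteq> (\<Union>n :: nat. A (from_nat n))"
  proof
    fix x assume "x \<in> (\<Union>j. A j)"
    then obtain j where "x \<in> A j" by blast
    then have "x \<in> A (from_nat (to_nat j))" by simp
    then show "x \<in> (\<Union>n :: nat. A (from_nat n))" by blast
  qed
  ultimately show ?thesis by (rule null_cover_subset)
qed

lemma null_cover_empty: "null_cover s ({} :: 'a::metric_space set)"
  unfolding null_cover_def
  by (intro allI impI exI[of _ "\<lambda>_. {}"]) (auto simp: hausdorff_gauge_def)

lemma null_cover_Un:
  assumes "null_cover s A" "null_cover s B"
  shows "null_cover s (A \<union> B)"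
proof -
  have "null_cover s (\<Union>b. if b then A else B)"
    by (rule null_cover_countable) (use assms in auto)
  then show ?thesis by (rule null_cover_subset) auto
qed

section \<open>Best approximations with weights\<close>

locale weights =
  fixes w :: "'d::finite \<Rightarrow> real" and d :: real
  assumes w_pos: "\<And>i. 0 < w i" and w_sum: "(\<Sum>i\<in>UNIV. w i) = 1"
    and d_def: "d = real CARD('d)"
begin

lemma d_ge: "d \<ge> 1" by (simp add: d_def Suc_leI)

lemma w_le: "w i \<le> 1"
  using member_le_sum[of i UNIV w] w_pos w_sum by (auto intro: less_imp_le)

lemma prod_powr: "a > 0 \<Longrightarrow> (\<Prod>i\<in>UNIV. a powr w i) = a"
  using powr_sum[of a w UNIV] w_sum by simp

lemma powr_double: "0 < r \<Longrightarrow> (2 * r) powr w i \<le> 2 * r powr w i"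
  using w_le[of i] powr_mono[of "w i" 1 2] by (simp add: powr_mult)

text \<open>For \<open>r >= 0\<close> this bounds the weighted quasi-norm of the displacement by
  \<open>r\<close>, written as a box whose sides are different powers of \<open>r\<close>.\<close>

definition close :: "('d \<Rightarrow> real) \<Rightarrow> 'd point \<Rightarrow> real \<Rightarrow> bool" where
  "close x v r \<longleftrightarrow> (\<forall>i. \<bar>of_int (snd v) * x i - of_int (fst v i)\<bar> \<le> r powr w i)"

text \<open>The property of best approximations: an open tube of length \<open>Q\<close> around the
  line through \<open>(x, 1)\<close> has no nonzero lattice point. It makes lattice points separated
  once coordinates are measured in units of the tube.\<close>

definition gap :: "('d \<Rightarrow> real) \<Rightarrow> int \<Rightarrow> real \<Rightarrow> bool" where
  "gap x Q r \<longleftrightarrow> (\<forall>y y0. (y, y0) \<noteq> ((\<lambda>_. 0), 0) \<longrightarrow> \<bar>y0\<bar> < Q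
      \<longrightarrow> (\<exists>i. r powr w i \<le> \<bar>of_int y0 * x i - of_int (y i)\<bar>))"

text \<open>The point \<open>x\<close> is quantified away, so that the successors of
  \<open>v\<close> for all \<open>x\<close> are counted together. The radius \<open>r\<close> stands
  for the residue of \<open>v\<close>.\<close>

definition consecutive :: "real \<Rightarrow> 'd point \<Rightarrow> 'd point \<Rightarrow> bool" where
  "consecutive \<epsilon> v z \<longleftrightarrow> (\<exists>x r. 0 < r \<and> r * of_int (snd z) < \<epsilon> \<and> snd v < snd z
      \<and> close x v r \<and> close x z r \<and> gap x (snd z) r)"

text \<open>Scaling \<open>v\<close> to the denominator of \<open>z\<close> multiplies its residue
  by at most \<open>2 * L\<close>; together with the residue of \<open>z\<close> this gives
  \<open>2 * L + 1 <= 3 * L\<close>.\<close>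

lemma close_deviation:
  assumes "close x v r" "close x z r" "snd v > 0" "real_of_int (snd z) \<le> 2 * L * of_int (snd v)" "0 \<le> snd z" "1 \<le> L"
  shows "\<bar>of_int (fst z i) - of_int (snd z) * of_int (fst v i) / of_int (snd v)\<bar> \<le> 3 * L * r powr w i"
proof -
  let ?q = "real_of_int (snd v)"
  have 1: "\<bar>of_int (snd z) * x i - of_int (fst z i)\<bar> \<le> r powr w i"
    and 2: "\<bar>?q * x i - of_int (fst v i)\<bar> \<le> r powr w i" using assms(1,2) by (auto simp: close_def)
  have "of_int (fst z i) - of_int (snd z) * of_int (fst v i) / ?q
    = - (of_int (snd z) * x i - of_int (fst z i)) + (of_int (snd z) / ?q) * (?q * x i - of_int (fst v i))"
    using assms(3) by (simp add: field_simps)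
  also have "\<bar>\<dots>\<bar> \<le> r powr w i + (2 * L) * r powr w i"
  proof -
    have "0 \<le> of_int (snd z) / ?q" "of_int (snd z) / ?q \<le> 2 * L"
      using assms(3,4,5) by (auto simp: divide_le_eq)
    then have "\<bar>(of_int (snd z) / ?q) * (?q * x i - of_int (fst v i))\<bar> \<le> (2 * L) * r powr w i"
      unfolding abs_mult using 2 by (intro mult_mono) auto
    then show ?thesis using 1 by linarith
  qed
  also have "\<dots> \<le> 3 * L * r powr w i"
    using mult_right_mono[OF assms(6), of "r powr w i"] by (simp add: algebra_simps)
  finally show ?thesis .
qed

text \<open>Pigeonhole: as the weights add up to 1, the box with sides \<open>q powr w i\<close>,
  where \<open>q = snd v\<close>, has more than \<open>q\<close> integer vectors, so two of them
  have the same product with the numerators modulo \<open>q\<close>. Their difference is the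
  form.\<close>

lemma dirichlet_dual:
  assumes q: "snd v > 0"
  shows "\<exists>\<xi> \<xi>0. \<xi> \<noteq> (\<lambda>_. 0) \<and> (\<forall>i. \<bar>of_int (\<xi> i)\<bar> \<le> of_int (snd v) powr w i) \<and> lin \<xi> \<xi>0 v = 0"
proof -
  define N where "N i = \<lfloor>real_of_int (snd v) powr w i\<rfloor>" for i
  define Box where "Box = PiE (UNIV :: 'd set) (\<lambda>i. {0..N i})"
  define h where "h k = (\<Sum>i\<in>UNIV. k i * fst v i) mod snd v" for k
  have N0: "N i \<ge> 0" for i by (simp add: N_def)
  have finBox: "finite Box" unfolding Box_def by (intro finite_PiE) auto
  have "real_of_int (snd v) = (\<Prod>i\<in>UNIV. real_of_int (snd v) powr w i)" using q by (simp add: prod_powr)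
  also have "\<dots> < (\<Prod>i\<in>UNIV. real_of_int (N i + 1))"
    by (rule prod_mono_strict) (use q in \<open>auto simp: N_def floor_less_iff intro: add_nonneg_pos\<close>)
  also have "\<dots> = real (card Box)" using N0 by (simp add: Box_def card_PiE)
  finally have "nat (snd v) < card Box" using q by linarith
  moreover have "h ` Box \<subseteq> {0..<snd v}" using q by (auto simp: h_def)
  then have "card (h ` Box) \<le> nat (snd v)" using card_mono[of "{0..<snd v}" "h ` Box"] by simp
  ultimately have "card (h ` Box) < card Box" by linarith
  then have "\<not> inj_on h Box" using pigeonhole by blast
  then obtain k l where kl: "k \<in> Box" "l \<in> Box" "h k = h l" "k \<noteq> l" by (auto simp: inj_on_def)
  define \<xi> where "\<xi> i = k i - l i" for i
  have "snd v dvd (\<Sum>i\<in>UNIV. k i * fst v i) - (\<Sum>i\<in>UNIV. l i * fst v i)"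
    using kl(3) by (simp add: h_def mod_eq_dvd_iff)
  then have "snd v dvd (\<Sum>i\<in>UNIV. \<xi> i * fst v i)" by (simp add: \<xi>_def left_diff_distrib sum_subtractf)
  then obtain m where "(\<Sum>i\<in>UNIV. \<xi> i * fst v i) = snd v * m" by blast
  then have "lin \<xi> (- m) v = 0" by (simp add: lin_def)
  moreover have "\<xi> \<noteq> (\<lambda>_. 0)" using kl(4) by (auto simp: \<xi>_def fun_eq_iff)
  moreover have "\<bar>of_int (\<xi> i)\<bar> \<le> real_of_int (snd v) powr w i" for i
  proof -
    have "0 \<le> k i" "k i \<le> N i" "0 \<le> l i" "l i \<le> N i" using kl by (auto simp: Box_def PiE_iff)
    then have "\<bar>\<xi> i\<bar> \<le> N i" unfolding \<xi>_def by linarith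
    then show ?thesis unfolding N_def by linarith
  qed
  ultimately show ?thesis by blast
qed

text \<open>Consecutive best approximations leave a whole tube around \<open>x\<close> without lattice points. Translates
  of this tube cover the region that contains all successors, and each contains at most one of them.\<close>

lemma consecutive_count_hyperplane:
  assumes q: "snd v > 0" and L: "L \<ge> 1"
    and eta: "\<eta> \<noteq> (\<lambda>_. 0)" "lin \<eta> \<eta>0 v = 0"
    and A: "\<And>z. z \<in> A \<Longrightarrow> consecutive \<epsilon> v z \<and> L * of_int (snd v) \<le> of_int (snd z)
              \<and> of_int (snd z) < 2 * L * of_int (snd v) \<and> lin \<eta> \<eta>0 z = 0"
  shows "finite A" "real (card A) \<le> (8 * d + 2) * (34 * d * L) ^ (CARD('d) - 1)"
proof -
  have "finite A \<and> real (card A) \<le> (8 * d + 2) * (34 * d * L) ^ (CARD('d) - 1)"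
  proof (cases "A = {}")
    case True
    then show ?thesis using L d_ge by simp
  next
    case False
    define P where "P = (\<lambda>(z, x) r. z \<in> A \<and> 0 < r \<and> r * of_int (snd z) < \<epsilon>
      \<and> close x v r \<and> close x z r \<and> gap x (snd z) r)"
    have Pex: "\<exists>x r. P (z, x) r" if "z \<in> A" for z
      using A[OF that] that by (auto simp: P_def consecutive_def)
    have zpos: "snd z > 0" if "z \<in> A" for z
    proof -
      have "0 < L * of_int (snd v)" using L q by simp
      then have "0 < real_of_int (snd z)" using A[OF that] by linarith
      then show ?thesis by simp
    qed
    have Pbd: "0 < r \<and> r \<le> \<epsilon>" if "P a r" for a r
    proof -
      obtain z x where a: "a = (z, x)" by (cases a)
      have z: "z \<in> A" "0 < r" "r * of_int (snd z) < \<epsilon>" using that by (auto simp: P_def a)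
      have "1 \<le> snd z" using zpos[OF z(1)] by simp
      then have "1 \<le> real_of_int (snd z)" by linarith
      then have "r * 1 \<le> r * of_int (snd z)" using z by (intro mult_left_mono) auto
      then have "r \<le> \<epsilon>" using z(3) by linarith
      then show ?thesis using z(2) by simp
    qed
    obtain z0 where "z0 \<in> A" using False by blast
    from Pex[OF this] obtain x0 r0 where "P (z0, x0) r0" by (elim exE)
    then have "\<exists>a1 r1. P a1 r1 \<and> (\<forall>a r. P a r \<longrightarrow> r \<le> 2 * r1)" by (rule maximal_radius) (rule Pbd)
    then obtain a1 r1 where a1r1: "P a1 r1 \<and> (\<forall>a r. P a r \<longrightarrow> r \<le> 2 * r1)" by (elim exE)
    have a1: "P a1 r1" by (rule conjunct1[OF a1r1])
    have max: "r \<le> 2 * r1" if "P a r" for a r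
      by (rule mp[OF spec[OF spec[OF conjunct2[OF a1r1]]] that])
    \<comment> \<open>Up to the factor 2, the tube of \<open>z1\<close> is the widest among all
      candidates. Its width therefore bounds the deviations of all of them, and its emptiness still
      separates them.\<close>
    obtain z1 x1 where "a1 = (z1, x1)" by (cases a1)
    then have P1: "P (z1, x1) r1" using a1 by simp
    have r1: "0 < r1" and z1: "z1 \<in> A" and c1: "close x1 v r1" "close x1 z1 r1" and g1: "gap x1 (snd z1) r1"
      using P1 by (auto simp: P_def)
    define f where "f z i = (of_int (fst z i) - of_int (snd z) * x1 i) / r1 powr w i" for z i
    have rp: "r1 powr w i > 0" for i using r1 by simp
    have sep: "\<exists>i. 1 \<le> \<bar>f a i - f b i\<bar>" if ab: "a \<in> A" "b \<in> A" "a \<noteq> b" for a b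
    proof -
      have ne: "(\<lambda>i. fst a i - fst b i, snd a - snd b) \<noteq> ((\<lambda>_. 0), 0)"
        using ab(3) by (auto simp: prod_eq_iff fun_eq_iff)
      \<comment> \<open>All denominators lie in \<open>[L q, 2 L q)\<close>, so two of them differ
        by less than \<open>L q\<close>, and a tube of length \<open>snd z1\<close> is long
        enough.\<close>
      have lt: "\<bar>snd a - snd b\<bar> < snd z1"
        using A[OF ab(1)] A[OF ab(2)] A[OF z1] by linarith
      obtain i where "r1 powr w i
          \<le> \<bar>of_int (snd a - snd b) * x1 i - of_int (fst a i - fst b i)\<bar>"
        using g1[unfolded gap_def, rule_format, OF ne lt] by (elim exE)
      moreover have "f a i - f b i = - (of_int (snd a - snd b) * x1 i - of_int (fst a i - fst b i)) / r1 powr w i"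
        by (simp add: f_def algebra_simps flip: diff_divide_distrib)
      ultimately have "1 \<le> \<bar>f a i - f b i\<bar>" using rp[of i] by (simp add: abs_divide le_divide_eq)
      then show ?thesis by blast
    qed
    have bound: "\<bar>f z i\<bar> \<le> 8 * L" if z: "z \<in> A" for z i
    proof -
      obtain x r where Pz: "P (z, x) r" using Pex[OF z] by blast
      then have c: "close x v r" "close x z r" "0 < r" by (auto simp: P_def)
      have le: "r powr w i \<le> 2 * r1 powr w i"
      proof -
        have "r powr w i \<le> (2 * r1) powr w i" using c max[OF Pz] w_pos[of i] by (intro powr_mono2) auto
        also have "\<dots> \<le> 2 * r1 powr w i" using r1 by (rule powr_double)
        finally show ?thesis .
      qed
      have "\<bar>of_int (fst z i) - of_int (snd z) * of_int (fst v i) / of_int (snd v)\<bar> \<le> 3 * L * r powr w i"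
        using A[OF z] zpos[OF z] by (intro close_deviation[OF c(1,2) q _ _ L]) auto
      also have "\<dots> \<le> 3 * L * (2 * r1 powr w i)" using L le by (intro mult_left_mono) auto
      finally have e1: "\<bar>of_int (fst z i) - of_int (snd z) * of_int (fst v i) / of_int (snd v)\<bar> \<le> 6 * L * r1 powr w i"
        by simp
      have "\<bar>of_int (snd v) * x1 i - of_int (fst v i)\<bar> \<le> r1 powr w i" using c1 by (simp add: close_def)
      moreover have "0 \<le> of_int (snd z) / real_of_int (snd v)" "of_int (snd z) / real_of_int (snd v) \<le> 2 * L"
        using A[OF z] zpos[OF z] q by (auto simp: divide_le_eq)
      ultimately have e2: "\<bar>(of_int (snd z) / of_int (snd v)) * (of_int (snd v) * x1 i - of_int (fst v i))\<bar> \<le> 2 * L * r1 powr w i"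
        unfolding abs_mult by (intro mult_mono) auto
      have "of_int (fst z i) - of_int (snd z) * x1 i
        = (of_int (fst z i) - of_int (snd z) * of_int (fst v i) / of_int (snd v))
          - (of_int (snd z) / of_int (snd v)) * (of_int (snd v) * x1 i - of_int (fst v i))"
        using q by (simp add: field_simps)
      also have "\<bar>\<dots>\<bar> \<le> 6 * L * r1 powr w i + 2 * L * r1 powr w i"
        by (rule order_trans[OF abs_triangle_ineq4 add_mono[OF e1 e2]])
      finally have "\<bar>of_int (fst z i) - of_int (snd z) * x1 i\<bar> \<le> 8 * L * r1 powr w i" by simp
      then show ?thesis using rp[of i] by (simp add: f_def abs_divide divide_le_eq)
    qed
    define c where "c i = of_int (\<eta> i) * r1 powr w i" for i
    obtain i0 where i0: "\<And>i. \<bar>c i\<bar> \<le> \<bar>c i0\<bar>"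
      using ex_max_abs by blast
    obtain j where "\<eta> j \<noteq> 0" using eta(1) by auto
    then have "c j \<noteq> 0" using rp[of j] by (simp add: c_def)
    then have c0: "c i0 \<noteq> 0" using i0[of j] by auto
    \<comment> \<open>Every \<open>z\<close> satisfies the linear equation, but \<open>f\<close>
      measures displacements from the line through \<open>(x1, 1)\<close>, which shifts the form by
      \<open>snd z * H\<close>. Since \<open>z1\<close> lies in the tube, \<open>snd z1 * H\<close>
      is at most \<open>d\<close> times the largest coefficient, and the denominators differ at most
      by the factor 2.\<close>
    define H where "H = (\<Sum>i\<in>UNIV. of_int (\<eta> i) * x1 i) + of_int \<eta>0"
    have cf: "(\<Sum>i\<in>UNIV. c i * f z i) = - (of_int (snd z) * H)" if z: "z \<in> A" for z
    proof -
      have "(\<Sum>i\<in>UNIV. c i * f z i) = (\<Sum>i\<in>UNIV. of_int (\<eta> i) * (of_int (fst z i) - of_int (snd z) * x1 i))"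
        using rp r1 by (intro sum.cong refl) (auto simp: c_def f_def)
      then show ?thesis using lin_deviation[of \<eta> z x1 \<eta>0] A[OF z] by (simp add: H_def)
    qed
    have slab: "\<bar>\<Sum>i\<in>UNIV. c i * f z i\<bar> \<le> (2 * d) * \<bar>c i0\<bar>" if z: "z \<in> A" for z
    proof -
      have "\<bar>of_int (snd z1) * H\<bar> = \<bar>\<Sum>i\<in>UNIV. c i * f z1 i\<bar>" using cf[OF z1] by simp
      also have "\<dots> \<le> (\<Sum>i\<in>UNIV. \<bar>c i * f z1 i\<bar>)" by (rule sum_abs)
      also have "\<dots> \<le> (\<Sum>i\<in>(UNIV::'d set). \<bar>c i0\<bar>)"
      proof (rule sum_mono)
        fix i
        have "\<bar>of_int (snd z1) * x1 i - of_int (fst z1 i)\<bar> \<le> r1 powr w i" using c1 by (simp add: close_def)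
        then have "\<bar>f z1 i\<bar> \<le> 1" using rp[of i] by (simp add: f_def abs_divide divide_le_eq abs_minus_commute)
        then have "\<bar>c i\<bar> * \<bar>f z1 i\<bar> \<le> \<bar>c i0\<bar> * 1" using i0[of i] by (intro mult_mono) auto
        then show "\<bar>c i * f z1 i\<bar> \<le> \<bar>c i0\<bar>" by (simp add: abs_mult)
      qed
      finally have 1: "\<bar>of_int (snd z1) * H\<bar> \<le> d * \<bar>c i0\<bar>" by (simp add: d_def)
      have "\<bar>of_int (snd z)\<bar> \<le> 2 * \<bar>real_of_int (snd z1)\<bar>"
        using A[OF z] A[OF z1] zpos[OF z] zpos[OF z1] by linarith
      then have "\<bar>of_int (snd z)\<bar> * \<bar>H\<bar> \<le> (2 * \<bar>real_of_int (snd z1)\<bar>) * \<bar>H\<bar>"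
        by (rule mult_right_mono) simp
      then show ?thesis using 1 cf[OF z] by (simp add: abs_mult)
    qed
    note sc = slab_count[of A f "8 * L" "2 * d" c i0, OF sep bound _ _ c0 i0 slab]
    have fin: "finite A" by (rule sc(1)) (use L d_ge in auto)
    have "real (card A) \<le> (4 * (2 * d) + 2) * (4 * d * (8 * L) + 2) ^ (CARD('d) - 1)"
      unfolding d_def by (rule sc(2)[unfolded d_def]) (use L d_ge in \<open>auto simp: d_def\<close>)
    also have "\<dots> \<le> (8 * d + 2) * (34 * d * L) ^ (CARD('d) - 1)"
    proof -
      have "1 * 1 \<le> d * L" using d_ge L by (intro mult_mono) auto
      then have "4 * d * (8 * L) + 2 \<le> 34 * d * L" by (simp add: mult_ac)
      then show ?thesis using L d_ge by (intro mult_mono power_mono) auto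
    qed
    finally show ?thesis using fin by simp
  qed
  then show "finite A" "real (card A) \<le> (8 * d + 2) * (34 * d * L) ^ (CARD('d) - 1)" by auto
qed

text \<open>The radius is below \<open>\<epsilon> / snd z\<close>, hence at most
  \<open>\<epsilon> / (L * snd v)\<close>. This puts \<open>close_deviation\<close> into a form free
  of \<open>x\<close> and \<open>r\<close>.\<close>

lemma consecutive_deviation:
  assumes s: "consecutive \<epsilon> v z" and q: "snd v > 0" and L: "L \<ge> 1"
    and z: "L * of_int (snd v) \<le> of_int (snd z)" "of_int (snd z) < 2 * L * of_int (snd v)"
  shows "\<bar>of_int (fst z i) - of_int (snd z) * of_int (fst v i) / of_int (snd v)\<bar>
    \<le> 3 * L * (\<epsilon> / (L * of_int (snd v))) powr w i"
proof -
  obtain x r where r: "0 < r" "r * of_int (snd z) < \<epsilon>" "snd v < snd z" "close x v r" "close x z r"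
    using s by (auto simp: consecutive_def)
  have pos: "0 < L * real_of_int (snd v)" using L q by simp
  have "r * (L * of_int (snd v)) \<le> r * of_int (snd z)" using r(1) z(1) by (intro mult_left_mono) auto
  then have "r \<le> \<epsilon> / (L * of_int (snd v))" using r(2) pos by (subst pos_le_divide_eq) auto
  then have "r powr w i \<le> (\<epsilon> / (L * of_int (snd v))) powr w i"
    using r(1) w_pos[of i] by (intro powr_mono2) auto
  then have "3 * L * r powr w i \<le> 3 * L * (\<epsilon> / (L * of_int (snd v))) powr w i"
    using L by (intro mult_left_mono) auto
  moreover have "\<bar>of_int (fst z i) - of_int (snd z) * of_int (fst v i) / of_int (snd v)\<bar> \<le> 3 * L * r powr w i"
    using r q z by (intro close_deviation[OF r(4,5) q _ _ L]) auto
  ultimately show ?thesis by linarith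
qed

text \<open>The summands are the constants of the two cases in
  \<open>consecutive_count\<close>.\<close>

definition consecutive_const :: real where
  "consecutive_const = (8 * d + 2) * (34 * d) ^ (CARD('d) - 1) + 24 * (96 * d) ^ CARD('d)"

lemma consecutive_const_pos: "consecutive_const > 0"
proof -
  have "(8 * d + 2) * (34 * d) ^ (CARD('d) - 1) > 0" "24 * (96 * d) ^ CARD('d) > 0"
    using d_ge by auto
  then show ?thesis unfolding consecutive_const_def by linarith
qed

text \<open>A short dual vector confines all candidates to one hyperplane, because an integer of
  absolute value at most 1/8 is zero. The absence of such a vector is the hypothesis
  \<open>dual\<close> of \<open>transference_count\<close>.\<close>

lemma consecutive_count:
  assumes q: "snd v > 0" and L: "L \<ge> 1" and eps: "\<epsilon> > 0"
    and A: "\<And>z. z \<in> A \<Longrightarrow> consecutive \<epsilon> v z \<and> L * of_int (snd v) \<le> of_int (snd z)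
              \<and> of_int (snd z) < 2 * L * of_int (snd v)"
  shows "finite A" "real (card A) \<le> consecutive_const * (\<epsilon> * L ^ CARD('d) + L ^ (CARD('d) - 1))"
proof -
  let ?q = "real_of_int (snd v)"
  let ?n = "CARD('d)"
  have pos: "0 < L * ?q" using L q by simp
  define W where "W i = 3 * L * (\<epsilon> / (L * ?q)) powr w i" for i
  have W: "W i > 0" for i
  proof -
    have "\<epsilon> / (L * ?q) > 0" using eps pos by (rule divide_pos_pos)
    then have "(\<epsilon> / (L * ?q)) powr w i > 0" by (metis powr_gt_zero less_numeral_extra(3))
    then show ?thesis using L unfolding W_def by (intro mult_pos_pos) auto
  qed
  have dev: "\<bar>of_int (fst z i) - of_int (snd z) * of_int (fst v i) / ?q\<bar> \<le> W i" if "z \<in> A" for z i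
    unfolding W_def using A[OF that] by (intro consecutive_deviation[OF _ q L]) auto
  let ?a = "(8 * d + 2) * (34 * d) ^ (?n - 1)" and ?b = "24 * (96 * d) ^ ?n"
  let ?X = "\<epsilon> * L ^ ?n" and ?Y = "L ^ (?n - 1)"
  have nn: "0 \<le> ?a" "0 \<le> ?b" "0 \<le> ?X" "0 \<le> ?Y" using d_ge eps L by auto
  have "finite A \<and> real (card A) \<le> consecutive_const * (?X + ?Y)"
  proof (cases "\<exists>\<eta>. \<eta> \<noteq> (\<lambda>_. 0) \<and> (\<forall>i. \<bar>of_int (\<eta> i)\<bar> * W i \<le> 1 / (8 * d)) \<and> snd v dvd (\<Sum>i\<in>UNIV. \<eta> i * fst v i)")
    case True
    then obtain \<eta> m where eta: "\<eta> \<noteq> (\<lambda>_. 0)" "\<And>i. \<bar>of_int (\<eta> i)\<bar> * W i \<le> 1 / (8 * d)"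
      and m: "(\<Sum>i\<in>UNIV. \<eta> i * fst v i) = snd v * m" by (auto elim!: dvdE)
    have lv: "lin \<eta> (- m) v = 0" using m by (simp add: lin_def)
    have lz: "lin \<eta> (- m) z = 0" if z: "z \<in> A" for z
    proof -
      have "\<bar>real_of_int (lin \<eta> (- m) z)\<bar>
        = \<bar>\<Sum>i\<in>UNIV. of_int (\<eta> i) * (of_int (fst z i) - of_int (snd z) * of_int (fst v i) / ?q)\<bar>"
        using lin_deviation_point[OF _ lv, of z] q by simp
      also have "\<dots> \<le> (\<Sum>i\<in>UNIV. \<bar>of_int (\<eta> i) * (of_int (fst z i) - of_int (snd z) * of_int (fst v i) / ?q)\<bar>)"
        by (rule sum_abs)
      also have "\<dots> \<le> (\<Sum>i\<in>(UNIV::'d set). 1 / (8 * d))"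
      proof (rule sum_mono)
        fix i
        have "\<bar>real_of_int (\<eta> i)\<bar> * \<bar>of_int (fst z i) - of_int (snd z) * of_int (fst v i) / ?q\<bar>
          \<le> \<bar>real_of_int (\<eta> i)\<bar> * W i" using dev[OF z] by (intro mult_left_mono) auto
        then show "\<bar>of_int (\<eta> i) * (of_int (fst z i) - of_int (snd z) * of_int (fst v i) / ?q)\<bar> \<le> 1 / (8 * d)"
          using eta(2)[of i] by (simp add: abs_mult)
      qed
      also have "\<dots> = 1 / 8" using d_ge by (simp add: d_def)
      finally show ?thesis by linarith
    qed
    note sc = consecutive_count_hyperplane[OF q L eta(1) lv, of A \<epsilon>]
    have fin: "finite A" by (rule sc(1)) (use A lz in blast)
    have "real (card A) \<le> (8 * d + 2) * (34 * d * L) ^ (?n - 1)" by (rule sc(2)) (use A lz in blast)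
    also have "\<dots> = ?a * ?Y" by (simp add: power_mult_distrib)
    also have "\<dots> \<le> consecutive_const * (?X + ?Y)"
      unfolding consecutive_const_def using nn by (intro mult_mono) auto
    finally show ?thesis using fin by simp
  next
    case False
    note tc = transference_count[of "snd v" L W "fst v" A, OF q L W]
    have fin: "finite A"
      by (rule tc(1)) (use False A dev in \<open>auto simp: d_def\<close>)
    have "real (card A) \<le> 24 * L * ?q * (\<Prod>i\<in>UNIV. 32 * d * W i)"
      unfolding d_def by (rule tc(2)) (use False A dev in \<open>auto simp: d_def\<close>)
    also have "\<dots> = ?b * ?X"
    proof -
      \<comment> \<open>Because the weights add up to 1, the powers multiply to
        \<open>\<epsilon> / (L * q)\<close>, whose denominator cancels the factor
        \<open>L * q\<close> in front.\<close>
      have "(\<Prod>i\<in>UNIV. 32 * d * W i) = (\<Prod>i\<in>UNIV. (96 * d * L) * (\<epsilon> / (L * ?q)) powr w i)"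
        by (intro prod.cong refl) (simp add: W_def)
      also have "\<dots> = (96 * d * L) ^ ?n * (\<epsilon> / (L * ?q))"
        using eps pos by (simp add: prod.distrib prod_powr)
      finally show ?thesis using L q by (simp add: power_mult_distrib)
    qed
    also have "\<dots> \<le> consecutive_const * (?X + ?Y)"
      unfolding consecutive_const_def using nn by (intro mult_mono) auto
    finally show ?thesis using fin by simp
  qed
  then show "finite A" "real (card A) \<le> consecutive_const * (?X + ?Y)" by auto
qed

text \<open>The index \<open>None\<close> carries the denominator.\<close>

lemma run_count:
  assumes q: "snd v > 0" and L: "L \<ge> 1"
    and xi: "\<xi> \<noteq> (\<lambda>_. 0)" "lin \<xi> \<xi>0 v = 0"
    and A: "\<And>z. z \<in> A \<Longrightarrow> (\<exists>x r. 0 < r \<and> r * of_int (snd v) < \<epsilon> \<and> close x v r \<and> gap x (snd v) r \<and> close x z r)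
      \<and> L * of_int (snd v) \<le> of_int (snd z) \<and> of_int (snd z) < 2 * L * of_int (snd v) \<and> lin \<xi> \<xi>0 z = 0"
  shows "finite A" "real (card A) \<le> 2 * (100 * d * L) ^ CARD('d)"
proof -
  let ?q = "real_of_int (snd v)"
  have "finite A \<and> real (card A) \<le> 2 * (100 * d * L) ^ CARD('d)"
  proof (cases "A = {}")
    case True
    then show ?thesis using L d_ge by simp
  next
    case False
    \<comment> \<open>Here the tube is that of \<open>v\<close> and has only the length
      \<open>snd v\<close>, because the candidates may be much later approximations.\<close>
    define P where "P = (\<lambda>(x :: 'd \<Rightarrow> real) r. 0 < r \<and> r * ?q < \<epsilon> \<and> close x v r \<and> gap x (snd v) r)"
    have zpos: "snd z > 0" if "z \<in> A" for z
    proof -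
      have "0 < L * of_int (snd v)" using L q by simp
      then have "0 < real_of_int (snd z)" using A[OF that] by linarith
      then show ?thesis by simp
    qed
    have Pbd: "0 < r \<and> r \<le> \<epsilon>" if "P x r" for x r
    proof -
      have "1 \<le> ?q" using q by linarith
      then have "r * 1 \<le> r * ?q" using that by (intro mult_left_mono) (auto simp: P_def)
      moreover have "r * ?q < \<epsilon>" using that by (simp add: P_def)
      ultimately have "r \<le> \<epsilon>" by linarith
      then show ?thesis using that by (simp add: P_def)
    qed
    obtain x0 r0 where "P x0 r0" using False A unfolding P_def by blast
    then have "\<exists>x1 r1. P x1 r1 \<and> (\<forall>x r. P x r \<longrightarrow> r \<le> 2 * r1)" by (rule maximal_radius[where P = P and B = \<epsilon>]) (rule Pbd)
    then obtain x1 r1 where x1r1: "P x1 r1 \<and> (\<forall>x r. P x r \<longrightarrow> r \<le> 2 * r1)" by (elim exE)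
    have P1: "P x1 r1" by (rule conjunct1[OF x1r1])
    have max: "r \<le> 2 * r1" if "P x r" for x r
      by (rule mp[OF spec[OF spec[OF conjunct2[OF x1r1]]] that])
    have r1: "0 < r1" and c1: "close x1 v r1" and g1: "gap x1 (snd v) r1"
      using P1 by (auto simp: P_def)
    have rp: "r1 powr w i > 0" for i using r1 by simp
    define e where "e z i = of_int (fst z i) - of_int (snd z) * of_int (fst v i) / ?q" for z i
    \<comment> \<open>The factors 2 compensate for measuring from the line through \<open>v\<close>
      and not from that through \<open>(x1, 1)\<close>. When two images differ by less than 1, the
      denominators differ by less than \<open>q / 2\<close>, so the change of line costs at most
      half the width of the tube, and the deviations use up less than the other half.\<close>
    define f where "f z j = (case j of None \<Rightarrow> 2 * of_int (snd z) / ?q | Some i \<Rightarrow> 2 * e z i / r1 powr w i)" for z j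
    have sep: "\<exists>j. 1 \<le> \<bar>f a j - f b j\<bar>" if ab: "a \<in> A" "b \<in> A" "a \<noteq> b" for a b
    proof (rule ccontr)
      assume "\<not> ?thesis"
      then have lt: "\<bar>f a j - f b j\<bar> < 1" for j by (meson not_less)
      define y y0 where "y i = fst a i - fst b i" and "y0 = snd a - snd b" for i
      have "f a None - f b None = 2 * of_int y0 / ?q" by (simp add: f_def y0_def diff_divide_distrib right_diff_distrib)
      then have "\<bar>2 * of_int y0 / ?q\<bar> < 1" using lt[of None] by (simp only:)
      then have y0: "\<bar>real_of_int y0\<bar> < ?q / 2" using q by (simp add: abs_mult abs_divide divide_less_eq)
      then have yq: "\<bar>y0\<bar> < snd v" using q by linarith
      have ne: "(y, y0) \<noteq> ((\<lambda>_. 0), 0)"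
        using ab(3) by (auto simp: prod_eq_iff fun_eq_iff y_def y0_def)
      obtain i where i: "r1 powr w i \<le> \<bar>of_int y0 * x1 i - of_int (y i)\<bar>"
        using g1[unfolded gap_def, rule_format, OF ne yq] by (elim exE)
      have "f a (Some i) - f b (Some i) = 2 * (e a i - e b i) / r1 powr w i"
        by (simp add: f_def diff_divide_distrib right_diff_distrib)
      then have "\<bar>2 * (e a i - e b i) / r1 powr w i\<bar> < 1" using lt[of "Some i"] by (simp only:)
      then have "\<bar>2 * (e a i - e b i)\<bar> < r1 powr w i" using rp[of i] by (simp only: abs_divide divide_less_eq) simp
      then have "2 * \<bar>e a i - e b i\<bar> < r1 powr w i" by linarith
      moreover have "e a i - e b i = - (of_int y0 * x1 i - of_int (y i)) + (of_int y0 / ?q) * (?q * x1 i - of_int (fst v i))"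
        using q by (simp add: e_def y_def y0_def field_simps)
      moreover have "\<bar>(of_int y0 / ?q) * (?q * x1 i - of_int (fst v i))\<bar> \<le> (1 / 2) * r1 powr w i"
        unfolding abs_mult
      proof (rule mult_mono)
        show "\<bar>real_of_int y0 / ?q\<bar> \<le> 1 / 2" using y0 q by (simp add: abs_divide divide_le_eq)
        show "\<bar>?q * x1 i - of_int (fst v i)\<bar> \<le> r1 powr w i" using c1 by (simp add: close_def)
      qed auto
      moreover have False if "2 * \<bar>E\<bar> < R" "E = - X + T" "\<bar>T\<bar> \<le> 1 / 2 * R" "R \<le> \<bar>X\<bar>" for E X T R :: real
        using that by linarith
      ultimately show False using i by blast
    qed
    have bound: "\<bar>f z j\<bar> \<le> 12 * L" if z: "z \<in> A" for z j
    proof (cases j)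
      case None
      have "0 \<le> of_int (snd z) / ?q" "of_int (snd z) / ?q \<le> 2 * L"
        using A[OF z] zpos[OF z] q by (auto simp: divide_le_eq)
      then show ?thesis using L by (simp add: f_def None)
    next
      case (Some i)
      obtain x r where Px: "P x r" "close x z r" using A[OF z] by (auto simp: P_def)
      have le: "r powr w i \<le> 2 * r1 powr w i"
      proof -
        have "r powr w i \<le> (2 * r1) powr w i"
          using Px(1) max[OF Px(1)] w_pos[of i] by (intro powr_mono2) (auto simp: P_def)
        also have "\<dots> \<le> 2 * r1 powr w i" using r1 by (rule powr_double)
        finally show ?thesis .
      qed
      have "close x v r" using Px by (simp add: P_def)
      then have "\<bar>e z i\<bar> \<le> 3 * L * r powr w i" unfolding e_def
        using A[OF z] zpos[OF z] by (intro close_deviation[OF _ Px(2) q _ _ L]) auto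
      also have "\<dots> \<le> 3 * L * (2 * r1 powr w i)" using L le by (intro mult_left_mono) auto
      finally show ?thesis using rp[of i] by (simp add: f_def Some abs_mult divide_le_eq)
    qed
    define c where "c j = (case j of None \<Rightarrow> 0 | Some i \<Rightarrow> of_int (\<xi> i) * r1 powr w i)" for j
    obtain j0 where j0: "\<And>j. \<bar>c j\<bar> \<le> \<bar>c j0\<bar>"
      using ex_max_abs by blast
    obtain i where "\<xi> i \<noteq> 0" using xi(1) by auto
    then have "c (Some i) \<noteq> 0" using r1 by (simp add: c_def)
    then have c0: "c j0 \<noteq> 0" using j0[of "Some i"] by auto
    \<comment> \<open>The hyperplane contains the line through \<open>v\<close>, so in these
      coordinates it passes through the origin and does not involve \<open>None\<close>. The slab
      has width 0, and the \<open>d + 1\<close> coordinates give only the power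
      \<open>d\<close>.\<close>
    have slab: "\<bar>\<Sum>j\<in>UNIV. c j * f z j\<bar> \<le> 0 * \<bar>c j0\<bar>" if z: "z \<in> A" for z
    proof -
      have "(\<Sum>j\<in>UNIV. c j * f z j) = (\<Sum>i\<in>UNIV. 2 * (of_int (\<xi> i) * e z i))"
        using r1 by (simp add: UNIV_option_conv sum.reindex c_def f_def mult_ac)
      also have "\<dots> = 2 * real_of_int (lin \<xi> \<xi>0 z)"
        using lin_deviation_point[OF _ xi(2), of z] q by (simp add: e_def flip: sum_distrib_left)
      finally show ?thesis using A[OF z] by simp
    qed
    have card_opt: "CARD('d option) = CARD('d) + 1" by simp
    note sc = slab_count[of A f "12 * L" 0 c j0, OF sep bound _ _ c0 j0 slab]
    have fin: "finite A" by (rule sc(1)) (use L in auto)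
    have "real (card A) \<le> (4 * 0 + 2) * (4 * real CARD('d option) * (12 * L) + 2) ^ (CARD('d option) - 1)"
      by (rule sc(2)) (use L in auto)
    also have "4 * real CARD('d option) * (12 * L) + 2 = 48 * (d + 1) * L + 2"
      by (simp add: card_opt d_def algebra_simps)
    also have "(4 * 0 + 2) * (48 * (d + 1) * L + 2) ^ (CARD('d option) - 1) = 2 * (48 * (d + 1) * L + 2) ^ CARD('d)"
      by (simp only: card_opt) simp
    also have "\<dots> \<le> 2 * (100 * d * L) ^ CARD('d)"
    proof -
      have "1 * 1 \<le> d * L" "1 * L \<le> d * L" using d_ge L by (intro mult_mono; simp)+
      moreover have "48 * (d + 1) * L + 2 = 48 * (d * L) + 48 * L + 2" by (simp add: algebra_simps)
      ultimately have "48 * (d + 1) * L + 2 \<le> 100 * (d * L)" by linarith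
      then have "48 * (d + 1) * L + 2 \<le> 100 * d * L" by (simp add: mult.assoc)
      then show ?thesis using L d_ge by (intro mult_left_mono power_mono) auto
    qed
    finally show ?thesis using fin by simp
  qed
  then show "finite A" "real (card A) \<le> 2 * (100 * d * L) ^ CARD('d)" by auto
qed

definition wmin :: real where "wmin = Min (range w)"

lemma wmin: "0 < wmin" "wmin \<le> w i" "wmin \<le> 1"
proof -
  have "wmin \<in> range w" unfolding wmin_def by (rule Min_in) auto
  then show "0 < wmin" "wmin \<le> 1" using w_pos w_le by auto
  show "wmin \<le> w i" unfolding wmin_def by (rule Min_le) auto
qed

text \<open>A form with coefficients at most \<open>Q powr w i\<close> takes a nonzero integer value
  at \<open>z\<close>, while each coordinate of \<open>z\<close> deviates from the line through
  \<open>u\<close> by at most \<open>3 * L * (\<epsilon> / (M * Q)) powr w i\<close>. The powers of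
  \<open>Q\<close> cancel. So leaving the hyperplane late, with \<open>M\<close> large, forces a
  long jump \<open>L\<close>.\<close>

lemma exit_bound:
  assumes u: "consecutive \<epsilon> u z" and q: "Q > 0" and eps: "0 < \<epsilon>" "\<epsilon> \<le> 1" and L: "L \<ge> 1" and M: "M \<ge> 1"
    and xi: "\<And>i. \<bar>of_int (\<xi> i)\<bar> \<le> Q powr w i" "lin \<xi> \<xi>0 u = 0" "lin \<xi> \<xi>0 z \<noteq> 0"
    and u': "M * Q \<le> of_int (snd u)"
    and z: "L * of_int (snd u) \<le> of_int (snd z)" "of_int (snd z) < 2 * L * of_int (snd u)"
  shows "1 \<le> 3 * d * L * (\<epsilon> / M) powr wmin"
proof -
  have "0 < M * Q" using M q by simp
  then have u0: "0 < real_of_int (snd u)" using u' by linarith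
  have "1 \<le> \<bar>real_of_int (lin \<xi> \<xi>0 z)\<bar>" using xi(3) by linarith
  also have "\<dots> = \<bar>\<Sum>i\<in>UNIV. of_int (\<xi> i) * (of_int (fst z i) - of_int (snd z) * of_int (fst u i) / of_int (snd u))\<bar>"
    using lin_deviation_point[OF _ xi(2), of z] u0 by simp
  also have "\<dots> \<le> (\<Sum>i\<in>UNIV. \<bar>of_int (\<xi> i) * (of_int (fst z i) - of_int (snd z) * of_int (fst u i) / of_int (snd u))\<bar>)"
    by (rule sum_abs)
  also have "\<dots> \<le> (\<Sum>i\<in>(UNIV::'d set). 3 * L * (\<epsilon> / M) powr wmin)"
  proof (rule sum_mono)
    fix i
    have "\<bar>of_int (fst z i) - of_int (snd z) * of_int (fst u i) / real_of_int (snd u)\<bar>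
        \<le> 3 * L * (\<epsilon> / (L * of_int (snd u))) powr w i"
      using u0 by (intro consecutive_deviation[OF u _ L z]) simp
    also have "\<dots> \<le> 3 * L * (\<epsilon> / (M * Q)) powr w i"
    proof -
      have "1 * (M * Q) \<le> L * of_int (snd u)" using L u' \<open>0 < M * Q\<close> by (intro mult_mono) auto
      then have "\<epsilon> / (L * of_int (snd u)) \<le> \<epsilon> / (M * Q)"
        using eps L u0 q M by (intro divide_left_mono mult_pos_pos) auto
      then show ?thesis using L eps u0 w_pos[of i] by (intro mult_left_mono powr_mono2) auto
    qed
    finally have "\<bar>real_of_int (\<xi> i)\<bar> * \<bar>of_int (fst z i) - of_int (snd z) * of_int (fst u i) / real_of_int (snd u)\<bar>
      \<le> Q powr w i * (3 * L * (\<epsilon> / (M * Q)) powr w i)"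
      using xi(1)[of i] by (intro mult_mono) auto
    also have "\<dots> = 3 * L * (\<epsilon> / M) powr w i"
    proof -
      have "Q powr w i * (\<epsilon> / (M * Q)) powr w i = (Q * (\<epsilon> / (M * Q))) powr w i"
        using q eps M by (subst powr_mult) auto
      then show ?thesis using q by simp
    qed
    also have "\<dots> \<le> 3 * L * (\<epsilon> / M) powr wmin"
    proof -
      have "\<epsilon> / M \<le> 1" using eps M by simp
      then have "(\<epsilon> / M) powr w i \<le> (\<epsilon> / M) powr wmin"
        using eps M wmin(2)[of i] by (intro powr_mono') auto
      then show ?thesis using L by (intro mult_left_mono) auto
    qed
    finally show "\<bar>of_int (\<xi> i) * (of_int (fst z i) - of_int (snd z) * of_int (fst u i) / of_int (snd u))\<bar>
      \<le> 3 * L * (\<epsilon> / M) powr wmin" by (simp add: abs_mult)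
  qed
  finally show ?thesis by (simp add: d_def)
qed

section \<open>Leaving the dual hyperplane\<close>

text \<open>A choice that depends on \<open>v\<close> alone and not on \<open>x\<close>: one
  hyperplane serves all paths through \<open>v\<close>.\<close>

definition dual :: "'d point \<Rightarrow> ('d \<Rightarrow> int) \<times> int" where
  "dual v = (SOME p. fst p \<noteq> (\<lambda>_. 0) \<and> (\<forall>i. \<bar>of_int (fst p i)\<bar> \<le> real_of_int (snd v) powr w i)
      \<and> lin (fst p) (snd p) v = 0)"

abbreviation dual_lin :: "'d point \<Rightarrow> 'd point \<Rightarrow> int" where
  "dual_lin v \<equiv> lin (fst (dual v)) (snd (dual v))"

lemma dual:
  assumes "snd v > 0"
  shows "fst (dual v) \<noteq> (\<lambda>_. 0)" "\<bar>of_int (fst (dual v) i)\<bar> \<le> real_of_int (snd v) powr w i" "dual_lin v v = 0"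
proof -
  have "\<exists>p. fst p \<noteq> (\<lambda>_. 0) \<and> (\<forall>i. \<bar>of_int (fst p i)\<bar> \<le> real_of_int (snd v) powr w i)
      \<and> lin (fst p) (snd p) v = 0"
    using dirichlet_dual[OF assms] by simp
  from someI_ex[OF this] show "fst (dual v) \<noteq> (\<lambda>_. 0)"
    "\<bar>of_int (fst (dual v) i)\<bar> \<le> real_of_int (snd v) powr w i" "dual_lin v v = 0"
    unfolding dual_def[symmetric] by auto
qed

text \<open>The way from \<open>v\<close> to \<open>u\<close> is remembered only through the tube of
  \<open>v\<close> and the hyperplane, as \<open>run_count\<close> expects, and the step from
  \<open>u\<close> to \<open>z\<close> through \<open>consecutive\<close>, whose witness
  \<open>x\<close> may be another one.\<close>

definition transition :: "real \<Rightarrow> 'd point \<Rightarrow> 'd point \<Rightarrow> bool" where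
  "transition \<epsilon> v z \<longleftrightarrow> snd v > 0 \<and> (\<exists>u. (\<exists>x r. 0 < r \<and> r * of_int (snd v) < \<epsilon> \<and> close x v r
      \<and> gap x (snd v) r \<and> close x u r) \<and> snd v \<le> snd u \<and> dual_lin v u = 0 \<and> consecutive \<epsilon> u z \<and> dual_lin v z \<noteq> 0)"

lemma transition_denominator_less: "transition \<epsilon> v z \<Longrightarrow> 0 < snd v \<and> snd v < snd z"
  by (auto simp: transition_def consecutive_def)

text \<open>The factors stem from \<open>run_count\<close>, \<open>consecutive_count\<close> and the
  geometric series at the end of \<open>transition_sum\<close>, with \<open>16 = 4 * 4\<close> and
  \<open>192 = 3 * 8 * 8\<close>.\<close>

definition transition_const :: real where
  "transition_const = 2 * (100 * d) ^ CARD('d) * consecutive_const * (16 + 192 * d / wmin)"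

lemma transition_const_pos: "transition_const > 0"
  using consecutive_const_pos d_ge wmin(1) by (simp add: transition_const_def add_pos_pos)

text \<open>Let \<open>A\<close> and \<open>B\<close> be the dyadic sizes of
  \<open>snd u / snd v\<close> and \<open>snd z / snd u\<close>. There are \<open>O(A^d)\<close>
  points \<open>u\<close>, and for each of them \<open>O(\<epsilon> * B^d + B^(d-1))\<close> points
  \<open>z\<close> of relative weight at most \<open>(A * B)^-(d+\<kappa>)\<close>. The first term
  sums to \<open>O(\<epsilon> / \<kappa>^2)\<close>; the second becomes small through
  \<open>exit_bound\<close>.\<close>

lemma transition_sum:
  assumes kap: "0 < \<kappa>" "\<kappa> \<le> 1" and eps: "0 < \<epsilon>" "\<epsilon> \<le> 1"
    and F: "finite F" "\<And>z. z \<in> F \<Longrightarrow> transition \<epsilon> v z" and q: "snd v > 0"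
  shows "(\<Sum>z\<in>F. of_int (snd z) powr (- (d + \<kappa>)))
    \<le> transition_const * (\<epsilon> / \<kappa>\<^sup>2 + \<epsilon> powr (wmin / 2)) * of_int (snd v) powr (- (d + \<kappa>))"
proof -
  let ?q = "real_of_int (snd v)" and ?n = "CARD('d)"
  define s where "s = d + \<kappa>"
  have s: "s > 0" using d_ge kap by (simp add: s_def)
  define g where "g z = real_of_int (snd z) powr (- s)" for z :: "'d point"
  define U where "U a = {u. (\<exists>x r. 0 < r \<and> r * ?q < \<epsilon> \<and> close x v r \<and> gap x (snd v) r \<and> close x u r)
     \<and> dual_lin v u = 0 \<and> 2 ^ a * ?q \<le> of_int (snd u) \<and> of_int (snd u) < 2 * 2 ^ a * ?q}" for a :: nat
  define Z where "Z b u = {z. consecutive \<epsilon> u z \<and> dual_lin v z \<noteq> 0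
     \<and> 2 ^ b * of_int (snd u) \<le> real_of_int (snd z) \<and> of_int (snd z) < 2 * 2 ^ b * real_of_int (snd u)}"
     for b :: nat and u
  have two: "(2::real) ^ a \<ge> 1" for a by simp
  have U: "finite (U a)" "real (card (U a)) \<le> 2 * (100 * d * 2 ^ a) ^ ?n" for a
  proof -
    note rc = run_count[OF q two dual(1)[OF q] dual(3)[OF q], of "U a" \<epsilon> a]
    show "finite (U a)" by (rule rc(1)) (auto simp: U_def)
    show "real (card (U a)) \<le> 2 * (100 * d * 2 ^ a) ^ ?n" by (rule rc(2)) (auto simp: U_def)
  qed
  have upos: "snd u > 0" if "u \<in> U a" for u a
  proof -
    have "0 < 2 ^ a * ?q" using q by simp
    then have "0 < real_of_int (snd u)" using that by (simp add: U_def)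
    then show ?thesis by simp
  qed
  have Z: "finite (Z b u)" "real (card (Z b u)) \<le> consecutive_const * (\<epsilon> * (2 ^ b) ^ ?n + (2 ^ b) ^ (?n - 1))"
    if "u \<in> U a" for a b u
  proof -
    note sc = consecutive_count[OF upos[OF that] two eps(1), of "Z b u" b]
    show "finite (Z b u)" by (rule sc(1)) (auto simp: Z_def)
    show "real (card (Z b u)) \<le> consecutive_const * (\<epsilon> * (2 ^ b) ^ ?n + (2 ^ b) ^ (?n - 1))" by (rule sc(2)) (auto simp: Z_def)
  qed
  have Zexit: "1 \<le> 3 * d * 2 ^ b * (\<epsilon> / 2 ^ a) powr wmin" if "u \<in> U a" "z \<in> Z b u" for a b u z
    using that q by (intro exit_bound[OF _ _ eps two two dual(2)[OF q]]) (auto simp: Z_def U_def)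
  have "\<forall>z\<in>F. \<exists>a b u. u \<in> U a \<and> z \<in> Z b u"
  proof
    fix z assume "z \<in> F"
    then obtain u where u: "\<exists>x r. 0 < r \<and> r * of_int (snd v) < \<epsilon> \<and> close x v r
      \<and> gap x (snd v) r \<and> close x u r" "snd v \<le> snd u" "dual_lin v u = 0" "consecutive \<epsilon> u z" "dual_lin v z \<noteq> 0"
      using F(2) unfolding transition_def by blast
    have "snd u < snd z" using u(4) by (auto simp: consecutive_def)
    obtain a where a: "2 ^ a * ?q \<le> of_int (snd u)" "of_int (snd u) < 2 * 2 ^ a * ?q"
      using dyadic_index[of ?q "of_int (snd u)"] q u(2) by auto
    obtain b where b: "2 ^ b * of_int (snd u) \<le> real_of_int (snd z)" "of_int (snd z) < 2 * 2 ^ b * real_of_int (snd u)"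
      using dyadic_index[of "of_int (snd u)" "of_int (snd z)"] q u(2) \<open>snd u < snd z\<close> by auto
    have "u \<in> U a" using a u by (simp add: U_def)
    moreover have "z \<in> Z b u" using b u by (simp add: Z_def)
    ultimately show "\<exists>a b u. u \<in> U a \<and> z \<in> Z b u" by blast
  qed
  then obtain fa fb fu where f: "\<And>z. z \<in> F \<Longrightarrow> fu z \<in> U (fa z) \<and> z \<in> Z (fb z) (fu z)" by metis
  \<comment> \<open>As \<open>F\<close> is finite, finitely many dyadic classes suffice; the final
    bound does not depend on \<open>N\<close>.\<close>
  obtain N where N: "\<And>z. z \<in> F \<Longrightarrow> fa z \<le> N \<and> fb z \<le> N"
  proof -
    have "finite (fa ` F \<union> fb ` F)" using F(1) by simp
    then obtain N where "\<forall>n \<in> fa ` F \<union> fb ` F. n \<le> N" using finite_nat_set_iff_bounded_le by blast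
    then show thesis using that by blast
  qed
  define T where "T = (SIGMA a:{..N}. SIGMA b:{..N}. SIGMA u:U a. Z b u)"
  have finT: "finite T" unfolding T_def using U(1) Z(1) by (intro finite_SigmaI) auto
  have Fsub: "F \<subseteq> (\<lambda>(a, b, u, z). z) ` T"
  proof
    fix z assume "z \<in> F"
    then have "(fa z, fb z, fu z, z) \<in> T" using f N by (simp add: T_def)
    then show "z \<in> (\<lambda>(a, b, u, z). z) ` T" by (force simp: image_iff)
  qed
  have g0: "g z \<ge> 0" for z by (simp add: g_def)
  have "(\<Sum>z\<in>F. g z) \<le> (\<Sum>z\<in>(\<lambda>(a, b, u, z). z) ` T. g z)"
    using finT Fsub g0 by (intro sum_mono2) auto
  \<comment> \<open>A point \<open>z\<close> reached through several \<open>u\<close> is counted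
    repeatedly, which is harmless for nonnegative terms.\<close>
  also have "\<dots> \<le> (\<Sum>t\<in>T. (g \<circ> (\<lambda>(a, b, u, z). z)) t)"
    using finT g0 by (intro sum_image_le) auto
  also have "\<dots> = (\<Sum>a\<le>N. \<Sum>b\<le>N. \<Sum>u\<in>U a. \<Sum>z\<in>Z b u. g z)"
  proof -
    have "(\<Sum>t\<in>T. (g \<circ> (\<lambda>(a, b, u, z). z)) t) = (\<Sum>t\<in>T. case t of (a, y) \<Rightarrow> (case y of (b, u, z) \<Rightarrow> g z))"
      by (intro sum.cong) auto
    also have "\<dots> = (\<Sum>a\<le>N. \<Sum>y\<in>(SIGMA b:{..N}. SIGMA u:U a. Z b u). case y of (b, u, z) \<Rightarrow> g z)"
      unfolding T_def using U(1) Z(1) by (subst sum.Sigma) (auto intro!: finite_SigmaI)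
    also have "\<dots> = (\<Sum>a\<le>N. \<Sum>b\<le>N. \<Sum>y\<in>(SIGMA u:U a. Z b u). case y of (u, z) \<Rightarrow> g z)"
      using U(1) Z(1) by (intro sum.cong refl) (subst sum.Sigma, auto intro!: finite_SigmaI)
    also have "\<dots> = (\<Sum>a\<le>N. \<Sum>b\<le>N. \<Sum>u\<in>U a. \<Sum>z\<in>Z b u. g z)"
      using U(1) Z(1) by (intro sum.cong refl) (subst sum.Sigma, auto intro!: finite_SigmaI)
    finally show ?thesis .
  qed
  also have "\<dots> \<le> (\<Sum>a\<le>N. \<Sum>b\<le>N. 2 * (100 * d) ^ ?n * consecutive_const * ?q powr (- s) *
      (\<epsilon> * ((2 powr (- \<kappa>)) ^ a * (2 powr (- \<kappa>)) ^ b)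
       + 3 * d * \<epsilon> powr (wmin / 2) * ((2 powr (- (wmin / 2))) ^ a * (2 powr (- (1 / 2))) ^ b)))"
  proof (intro sum_mono)
    fix a b assume "a \<in> {..N}" "b \<in> {..N}"
    define A B where "A = (2::real) ^ a" and "B = (2::real) ^ b"
    have AB: "A \<ge> 1" "B \<ge> 1" by (simp_all add: A_def B_def)
    \<comment> \<open>\<open>E\<close> dominates the square root of the bound in
      \<open>exit_bound\<close>, so \<open>1 <= E\<close> whenever a candidate \<open>z\<close>
      exists, and the second term of the count may be multiplied by it. Taking the square root
      limits the growth in \<open>B\<close>: \<open>B powr (- 1) * B powr (1 / 2)\<close> is still
      summable, and a power of \<open>\<epsilon> / A\<close> is gained.\<close>
    define E where "E = 3 * d * \<epsilon> powr (wmin / 2) * (A powr (- (wmin / 2)) * B powr (1 / 2))"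
    have E0: "E \<ge> 0" using d_ge by (simp add: E_def)
    have inner: "(\<Sum>z\<in>Z b u. g z) \<le> consecutive_const * (\<epsilon> * B ^ ?n + B ^ (?n - 1) * E) * (A * B * ?q) powr (- s)"
      if u: "u \<in> U a" for u
    proof (cases "Z b u = {}")
      case True
      then show ?thesis using consecutive_const_pos eps AB E0 by (auto intro!: mult_nonneg_nonneg add_nonneg_nonneg)
    next
      case False
      then obtain z where z: "z \<in> Z b u" by blast
      have "1 \<le> 3 * d * B * (\<epsilon> / A) powr wmin" using Zexit[OF u z] by (simp add: A_def B_def)
      then have "1 powr (1 / 2) \<le> (3 * d * B * (\<epsilon> / A) powr wmin) powr (1 / 2)" by (intro powr_mono2) auto
      also have "\<dots> = (3 * d) powr (1 / 2) * (B powr (1 / 2) * (\<epsilon> / A) powr (wmin / 2))"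
        using AB d_ge by (simp add: powr_mult powr_powr)
      also have "\<dots> \<le> (3 * d) * (B powr (1 / 2) * (\<epsilon> / A) powr (wmin / 2))"
        using d_ge powr_mono[of "1/2" 1 "3 * d"] by (intro mult_right_mono) auto
      also have "\<dots> = E" using AB eps by (simp add: E_def powr_divide powr_minus divide_simps)
      finally have E1: "1 \<le> E" by simp
      have "(\<Sum>z\<in>Z b u. g z) \<le> (\<Sum>z\<in>Z b u. (A * B * ?q) powr (- s))"
      proof (rule sum_mono)
        fix z assume z: "z \<in> Z b u"
        have "B * (A * ?q) \<le> B * of_int (snd u)" using u AB by (intro mult_left_mono) (auto simp: U_def A_def)
        moreover have "B * of_int (snd u) \<le> of_int (snd z)" using z by (simp add: Z_def B_def)
        ultimately have "B * (A * ?q) \<le> of_int (snd z)" by linarith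
        then have "A * B * ?q \<le> of_int (snd z)" by (simp add: mult_ac)
        then show "g z \<le> (A * B * ?q) powr (- s)" unfolding g_def using s AB q by (intro powr_mono2') auto
      qed
      also have "\<dots> = real (card (Z b u)) * (A * B * ?q) powr (- s)" by simp
      also have "\<dots> \<le> consecutive_const * (\<epsilon> * B ^ ?n + B ^ (?n - 1) * 1) * (A * B * ?q) powr (- s)"
        using Z(2)[OF u, of b] by (intro mult_right_mono) (auto simp: B_def)
      also have "\<dots> \<le> consecutive_const * (\<epsilon> * B ^ ?n + B ^ (?n - 1) * E) * (A * B * ?q) powr (- s)"
        using consecutive_const_pos AB E1 by (intro mult_right_mono mult_left_mono add_left_mono) auto
      finally show ?thesis .
    qed
    let ?R = "consecutive_const * (\<epsilon> * B ^ ?n + B ^ (?n - 1) * E) * (A * B * ?q) powr (- s)"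
    have R0: "?R \<ge> 0" using consecutive_const_pos eps AB E0 by (auto intro!: mult_nonneg_nonneg add_nonneg_nonneg)
    have "(\<Sum>u\<in>U a. \<Sum>z\<in>Z b u. g z) \<le> (\<Sum>u\<in>U a. ?R)" by (intro sum_mono inner)
    also have "\<dots> = real (card (U a)) * ?R" by simp
    also have "\<dots> \<le> (2 * (100 * d) ^ ?n * A ^ ?n) * ?R"
      using U(2)[of a] R0 by (intro mult_right_mono) (auto simp: A_def power_mult_distrib)
    also have "\<dots> = 2 * (100 * d) ^ ?n * consecutive_const * ?q powr (- s)
       * (\<epsilon> * ((A ^ ?n * A powr (- s)) * (B ^ ?n * B powr (- s)))
          + (A ^ ?n * A powr (- s)) * (B ^ (?n - 1) * B powr (- s)) * E)"
      using AB q by (simp add: powr_mult algebra_simps)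
    also have "\<dots> \<le> 2 * (100 * d) ^ ?n * consecutive_const * ?q powr (- s) *
      (\<epsilon> * ((2 powr (- \<kappa>)) ^ a * (2 powr (- \<kappa>)) ^ b)
       + 3 * d * \<epsilon> powr (wmin / 2) * ((2 powr (- (wmin / 2))) ^ a * (2 powr (- (1 / 2))) ^ b))"
    proof -
      have pw: "X ^ ?n * X powr (- s) = X powr (- \<kappa>)" if "X \<ge> 1" for X :: real
        using that by (simp add: s_def d_def powr_diff powr_realpow powr_minus divide_simps)
      have pw1: "X ^ (?n - 1) * X powr (- s) \<le> X powr (- 1)" if X: "X \<ge> 1" for X :: real
      proof -
        have "X ^ (?n - 1) = X powr (d - 1)"
          using X by (simp add: d_def powr_realpow[symmetric] of_nat_diff Suc_leI)
        then have "X ^ (?n - 1) * X powr (- s) = X powr (- 1 - \<kappa>)" by (simp add: s_def flip: powr_add)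
        also have "\<dots> \<le> X powr (- 1)" using X kap by (intro powr_mono) auto
        finally show ?thesis .
      qed
      have a1: "A powr (- \<kappa>) \<le> 1" using AB kap powr_mono[of "- \<kappa>" 0 A] by simp
      have "A powr (- \<kappa>) * (B ^ (?n - 1) * B powr (- s)) * E \<le> 1 * B powr (- 1) * E"
        using a1 pw1[OF AB(2)] E0 AB by (intro mult_right_mono mult_mono) auto
      also have "\<dots> = 3 * d * \<epsilon> powr (wmin / 2) * (A powr (- (wmin / 2)) * (B powr (- 1) * B powr (1 / 2)))"
        by (simp add: E_def)
      also have "B powr (- 1) * B powr (1 / 2) = B powr (- (1 / 2))" by (subst powr_add[symmetric]) simp
      finally have "A powr (- \<kappa>) * (B ^ (?n - 1) * B powr (- s)) * E
        \<le> 3 * d * \<epsilon> powr (wmin / 2) * (A powr (- (wmin / 2)) * B powr (- (1 / 2)))" .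
      then show ?thesis
        using consecutive_const_pos d_ge unfolding pw[OF AB(1)] pw[OF AB(2)]
        unfolding A_def B_def power_two_powr by (intro mult_left_mono add_left_mono) auto
    qed
    finally show "(\<Sum>u\<in>U a. \<Sum>z\<in>Z b u. g z) \<le> 2 * (100 * d) ^ ?n * consecutive_const * ?q powr (- s) *
      (\<epsilon> * ((2 powr (- \<kappa>)) ^ a * (2 powr (- \<kappa>)) ^ b)
       + 3 * d * \<epsilon> powr (wmin / 2) * ((2 powr (- (wmin / 2))) ^ a * (2 powr (- (1 / 2))) ^ b))" .
  qed
  also have "\<dots> = 2 * (100 * d) ^ ?n * consecutive_const * ?q powr (- s) *
      (\<epsilon> * ((\<Sum>a\<le>N. (2 powr (- \<kappa>)) ^ a) * (\<Sum>b\<le>N. (2 powr (- \<kappa>)) ^ b))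
       + 3 * d * \<epsilon> powr (wmin / 2) * ((\<Sum>a\<le>N. (2 powr (- (wmin / 2))) ^ a) * (\<Sum>b\<le>N. (2 powr (- (1 / 2))) ^ b)))"
    unfolding sum_product by (simp only: sum_distrib_left[symmetric] sum.distrib)
  also have "\<dots> \<le> 2 * (100 * d) ^ ?n * consecutive_const * ?q powr (- s) *
      (\<epsilon> * ((4 / \<kappa>) * (4 / \<kappa>)) + 3 * d * \<epsilon> powr (wmin / 2) * ((4 / (wmin / 2)) * (4 / (1 / 2))))"
    using consecutive_const_pos d_ge eps kap wmin
    by (intro mult_left_mono add_mono mult_mono geometric_powr_le sum_nonneg mult_nonneg_nonneg) auto
  also have "\<dots> \<le> transition_const * (\<epsilon> / \<kappa>\<^sup>2 + \<epsilon> powr (wmin / 2)) * ?q powr (- s)"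
  proof -
    let ?Y = "2 * (100 * d) ^ ?n * consecutive_const * ?q powr (- s)"
    have "\<epsilon> * ((4 / \<kappa>) * (4 / \<kappa>)) + 3 * d * \<epsilon> powr (wmin / 2) * ((4 / (wmin / 2)) * (4 / (1 / 2)))
      = 16 * (\<epsilon> / \<kappa>\<^sup>2) + (192 * d / wmin) * \<epsilon> powr (wmin / 2)"
      using wmin(1) kap by (simp add: power2_eq_square field_simps)
    also have "\<dots> \<le> (16 + 192 * d / wmin) * (\<epsilon> / \<kappa>\<^sup>2) + (16 + 192 * d / wmin) * \<epsilon> powr (wmin / 2)"
      using eps d_ge wmin by (intro add_mono mult_right_mono) auto
    finally have "?Y * (\<epsilon> * ((4 / \<kappa>) * (4 / \<kappa>)) + 3 * d * \<epsilon> powr (wmin / 2) * ((4 / (wmin / 2)) * (4 / (1 / 2))))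
      \<le> ?Y * ((16 + 192 * d / wmin) * (\<epsilon> / \<kappa>\<^sup>2) + (16 + 192 * d / wmin) * \<epsilon> powr (wmin / 2))"
      using consecutive_const_pos d_ge by (intro mult_left_mono) auto
    also have "\<dots> = transition_const * (\<epsilon> / \<kappa>\<^sup>2 + \<epsilon> powr (wmin / 2)) * ?q powr (- s)"
      by (simp only: transition_const_def distrib_left mult_ac)
    finally show ?thesis .
  qed
  finally show ?thesis by (simp only: g_def s_def)
qed

section \<open>Best approximations of a single point\<close>

definition nearest :: "('d \<Rightarrow> real) \<Rightarrow> int \<Rightarrow> 'd \<Rightarrow> int" where
  "nearest x q i = round (of_int q * x i)"

text \<open>The weighted distance of \<open>q x\<close> from the integer lattice: rounding each
  coordinate minimises all terms at once.\<close>

definition residue :: "('d \<Rightarrow> real) \<Rightarrow> int \<Rightarrow> real" where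
  "residue x q = (MAX i. \<bar>of_int q * x i - of_int (nearest x q i)\<bar> powr (1 / w i))"

lemma residue_ge: "\<bar>of_int q * x i - of_int (nearest x q i)\<bar> powr (1 / w i) \<le> residue x q"
  unfolding residue_def by (rule Max_ge) auto

lemma residue_nonneg: "0 \<le> residue x q"
  using residue_ge[of q x undefined] by (rule order_trans[rotated]) simp

lemma close_nearest:
  assumes "residue x q \<le> r"
  shows "close x (nearest x q, q) r"
  unfolding close_def
proof
  fix i
  let ?y = "\<bar>of_int q * x i - of_int (nearest x q i)\<bar>"
  have "?y = (?y powr (1 / w i)) powr w i" using w_pos[of i] by (simp add: powr_powr)
  also have "\<dots> \<le> r powr w i"
    using order_trans[OF residue_ge[of q x i] assms] w_pos[of i] by (intro powr_mono2) auto
  finally show "\<bar>of_int (snd (nearest x q, q)) * x i - of_int (fst (nearest x q, q) i)\<bar> \<le> r powr w i" by simp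
qed

lemma residue_less:
  assumes r: "0 < r" and lt: "\<And>i. \<bar>of_int q * x i - of_int (y i)\<bar> < r powr w i"
  shows "residue x q < r"
proof -
  have "\<bar>of_int q * x i - of_int (nearest x q i)\<bar> powr (1 / w i) < r" for i
  proof -
    have "\<bar>of_int q * x i - of_int (nearest x q i)\<bar> \<le> \<bar>of_int q * x i - of_int (y i)\<bar>"
      unfolding nearest_def using round_diff_minimal[of "of_int q * x i" "y i"] by (simp add: abs_minus_commute)
    then have "\<bar>of_int q * x i - of_int (nearest x q i)\<bar> < r powr w i" using lt[of i] by linarith
    then have "\<bar>of_int q * x i - of_int (nearest x q i)\<bar> powr (1 / w i) < (r powr w i) powr (1 / w i)"
      using w_pos[of i] by (intro powr_less_mono2) auto
    then show ?thesis using r w_pos[of i] by (simp add: powr_powr)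
  qed
  then show ?thesis unfolding residue_def by (subst Max_less_iff) auto
qed

text \<open>For a positive denominator \<open>q\<close> this is \<open>close x v (1 / q)\<close>
  divided by \<open>q\<close>. The sides depend on \<open>v\<close> alone, so the boxes can serve as
  a cover.\<close>

definition in_box :: "('d \<Rightarrow> real) \<Rightarrow> 'd point \<Rightarrow> bool" where
  "in_box x v \<longleftrightarrow> (\<forall>i. \<bar>x i - of_int (fst v i) / of_int (snd v)\<bar> \<le> of_int (snd v) powr (- 1 - w i))"

text \<open>Outside all rational hyperplanes no residue vanishes, and the best approximations form
  an infinite sequence. It cannot stay in a hyperplane forever, so each term has a transition to a
  later one.\<close>

lemma transition_path:
  fixes x :: "'d \<Rightarrow> real"
  assumes eps: "0 < \<epsilon>" "\<epsilon> \<le> 1"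
    and irr: "\<And>\<xi> \<xi>0. \<xi> \<noteq> (\<lambda>_. 0) \<Longrightarrow> (\<Sum>i\<in>UNIV. of_int (\<xi> i) * x i) + of_int \<xi>0 \<noteq> 0"
    and DI: "\<And>T. T \<ge> T0 \<Longrightarrow> \<exists>q. 0 < q \<and> of_int q < T \<and> residue x q < \<epsilon> / T"
  shows "\<exists>V. \<forall>n. transition \<epsilon> (V n) (V (Suc n)) \<and> in_box x (V n)"
proof -
  define N where "N = max 1 \<lceil>T0\<rceil>"
  have N: "N \<ge> 1" "T0 \<le> of_int N" by (auto simp: N_def) linarith
  have rpos: "residue x q > 0" if "q > 0" for q
  proof (rule ccontr)
    assume "\<not> residue x q > 0"
    then have "residue x q \<le> 0" by simp
    from close_nearest[OF this] have z: "of_int q * x i = of_int (nearest x q i)" for i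
      by (simp add: close_def)
    \<comment> \<open>A vanishing residue makes every \<open>q * x i\<close> an integer, so one
      coordinate of \<open>x\<close> is a fixed rational number; \<open>undefined\<close> is just
      some index.\<close>
    define \<xi> where "\<xi> i = (if i = undefined then q else 0)" for i :: 'd
    have "\<xi> \<noteq> (\<lambda>_. 0)" using that by (auto simp: \<xi>_def fun_eq_iff)
    moreover have "(\<Sum>i\<in>UNIV. of_int (\<xi> i) * x i) = of_int (nearest x q undefined)"
    proof -
      have "(\<Sum>i\<in>UNIV. of_int (\<xi> i) * x i) = (\<Sum>i\<in>UNIV. if i = undefined then of_int q * x i else 0)"
        by (intro sum.cong) (auto simp: \<xi>_def)
      then show ?thesis by (simp add: z)
    qed
    ultimately show False using irr[of \<xi> "- nearest x q undefined"] by simp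
  qed
  \<comment> \<open>Minimality also over all \<open>p <= N\<close> forces every later record beyond
    \<open>N >= T0\<close>. Thus the hypothesis \<open>DI\<close> applies with \<open>T\<close>
    equal to the next denominator, from the first step on.\<close>
  define I where "I q \<longleftrightarrow> 0 < q \<and> (\<forall>p. 0 < p \<and> (p \<le> q \<or> p \<le> N) \<longrightarrow> residue x q \<le> residue x p)" for q
  define J where "J q q' \<longleftrightarrow> q < q' \<and> N < q' \<and> residue x q' < residue x q \<and> (\<forall>p. 0 < p \<and> p < q' \<longrightarrow> residue x q \<le> residue x p)" for q q'
  have start: "\<exists>q. I q"
  proof -
    have "\<exists>q\<in>{1..N}. \<forall>p\<in>{1..N}. residue x q \<le> residue x p"
    proof -
      have "Min (residue x ` {1..N}) \<in> residue x ` {1..N}" using N by (intro Min_in) auto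
      then obtain q where "q \<in> {1..N}" "Min (residue x ` {1..N}) = residue x q" by (rule imageE) auto
      moreover have "Min (residue x ` {1..N}) \<le> residue x p" if "p \<in> {1..N}" for p using that by (intro Min_le) auto
      ultimately show ?thesis by metis
    qed
    then obtain q where q: "q \<in> {1..N}" "\<And>p. p \<in> {1..N} \<Longrightarrow> residue x q \<le> residue x p" by blast
    have "I q" unfolding I_def using q by auto
    then show ?thesis ..
  qed
  have step: "\<exists>q'. I q' \<and> J q q'" if I: "I q" for q
  proof -
    have q: "0 < q" "\<And>p. 0 < p \<Longrightarrow> p \<le> q \<or> p \<le> N \<Longrightarrow> residue x q \<le> residue x p" using I by (auto simp: I_def)
    \<comment> \<open>This choice gives \<open>\<epsilon> / T <= residue x q\<close>, so
      \<open>DI\<close> yields a strictly smaller residue.\<close>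
    define T where "T = max T0 (\<epsilon> / residue x q)"
    obtain p0 where p0: "0 < p0" "residue x p0 < \<epsilon> / T" using DI[of T] by (auto simp: T_def)
    have "\<epsilon> / residue x q > 0" using eps rpos[OF q(1)] by simp
    moreover have "\<epsilon> / residue x q \<le> T" by (simp add: T_def)
    ultimately have "\<epsilon> / T \<le> \<epsilon> / (\<epsilon> / residue x q)"
      using eps by (intro divide_left_mono mult_pos_pos) auto
    then have "\<epsilon> / T \<le> residue x q" using eps by simp
    then have "residue x (int (nat p0)) < residue x q \<and> 0 < nat p0" using p0 by simp
    then have ex: "\<exists>n. residue x (int n) < residue x q \<and> 0 < n" by blast
    define n where "n = (LEAST n. residue x (int n) < residue x q \<and> 0 < n)"
    have n: "residue x (int n) < residue x q" "0 < n" using LeastI_ex[OF ex] by (auto simp: n_def)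
    have least: "residue x q \<le> residue x p" if p: "0 < p" "p < int n" for p
    proof (rule ccontr)
      assume "\<not> ?thesis"
      then have "residue x (int (nat p)) < residue x q \<and> 0 < nat p" using p by simp
      then have "n \<le> nat p" unfolding n_def by (rule Least_le)
      then show False using p by linarith
    qed
    have "q < int n \<and> N < int n"
    proof (rule ccontr)
      assume "\<not> ?thesis"
      then have "residue x q \<le> residue x (int n)" using n by (intro q(2)) auto
      then show False using n by simp
    qed
    then have "J q (int n)" using n least by (auto simp: J_def)
    moreover have "I (int n)" unfolding I_def
    proof (intro conjI allI impI)
      show "0 < int n" using n by simp
      fix p assume p: "0 < p \<and> (p \<le> int n \<or> p \<le> N)"
      show "residue x (int n) \<le> residue x p"
      proof (cases "p < int n")
        case True then show ?thesis using least[of p] p n by linarith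
      next
        case False
        then have "p = int n" using p \<open>q < int n \<and> N < int n\<close> by linarith
        then show ?thesis by simp
      qed
    qed
    ultimately show ?thesis by blast
  qed
  obtain Q where Q: "\<And>n. I (Q n)" "\<And>n. J (Q n) (Q (Suc n))"
    using dependent_nat_choice[of "\<lambda>_. I" "\<lambda>_. J"] start step by metis
  have Qpos: "0 < Q n" for n using Q(1)[of n] by (simp add: I_def)
  have Qstep: "Q n < Q (Suc n)" "N < Q (Suc n)" "residue x (Q (Suc n)) < residue x (Q n)"
    "\<And>p. 0 < p \<Longrightarrow> p < Q (Suc n) \<Longrightarrow> residue x (Q n) \<le> residue x p" for n
    using Q(2)[of n] by (auto simp: J_def)
  have Qge: "int n \<le> Q n" for n
  proof (induction n)
    case 0 show ?case using Qpos[of 0] by simp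
  next
    case (Suc n) then show ?case using Qstep(1)[of n] by simp
  qed
  have radmono: "residue x (Q m) \<le> residue x (Q n)" if "n \<le> m" for n m
    using that by (induction rule: dec_induct) (use Qstep(3) in \<open>auto intro: order_trans less_imp_le\<close>)
  have Qmono: "Q n \<le> Q m" if "n \<le> m" for n m
    using that by (induction rule: dec_induct) (use Qstep(1) in \<open>auto intro: order_trans less_imp_le\<close>)
  have rQ: "residue x (Q n) * of_int (Q (Suc n)) < \<epsilon>" for n
  proof -
    have pos: "0 < real_of_int (Q (Suc n))" using Qpos[of "Suc n"] by simp
    have "of_int (Q (Suc n)) \<ge> T0" using Qstep(2)[of n] N(2) by linarith
    from DI[OF this] obtain q where q: "0 < q" "of_int q < real_of_int (Q (Suc n))" "residue x q < \<epsilon> / of_int (Q (Suc n))" by blast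
    then have "residue x (Q n) \<le> residue x q" by (intro Qstep(4)) auto
    then have "residue x (Q n) < \<epsilon> / of_int (Q (Suc n))" using q(3) by linarith
    then show ?thesis using pos by (simp add: pos_less_divide_eq)
  qed
  have rQ': "residue x (Q n) * of_int (Q n) < \<epsilon>" for n
  proof -
    have "residue x (Q n) * of_int (Q n) \<le> residue x (Q n) * of_int (Q (Suc n))"
      using Qstep(1)[of n] residue_nonneg by (intro mult_left_mono) auto
    then show ?thesis using rQ[of n] by linarith
  qed
  have r1: "residue x (Q n) \<le> 1" for n
  proof -
    have "residue x (Q n) * 1 \<le> residue x (Q n) * of_int (Q n)"
      using Qpos[of n] residue_nonneg[of x "Q n"] by (intro mult_left_mono) auto
    then show ?thesis using rQ'[of n] eps by linarith
  qed
  define v where "v n = (nearest x (Q n), Q n)" for n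
  have cl: "close x (v m) (residue x (Q n))" if "n \<le> m" for n m
    unfolding v_def by (rule close_nearest[OF radmono[OF that]])
  have gp: "gap x (Q (Suc n)) (residue x (Q n))" for n
    unfolding gap_def
  proof (intro allI impI)
    fix y :: "'d \<Rightarrow> int" and y0 assume y: "(y, y0) \<noteq> ((\<lambda>_. 0 :: int), 0 :: int)" "\<bar>y0\<bar> < Q (Suc n)"
    show "\<exists>i. residue x (Q n) powr w i \<le> \<bar>of_int y0 * x i - of_int (y i)\<bar>"
    proof (cases "y0 = 0")
      \<comment> \<open>A nonzero vector with \<open>y0 = 0\<close> has an entry of absolute value
        at least 1, and no residue exceeds 1.\<close>
      case True
      then obtain i where "y i \<noteq> 0" using y(1) by (auto simp: fun_eq_iff)
      then have "1 \<le> \<bar>y i\<bar>" by linarith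
      then have "1 \<le> \<bar>real_of_int (y i)\<bar>" by linarith
      moreover have "residue x (Q n) powr w i \<le> 1"
        using r1[of n] residue_nonneg[of x "Q n"] w_pos[of i] by (intro powr_le1) auto
      ultimately have "residue x (Q n) powr w i \<le> \<bar>of_int y0 * x i - of_int (y i)\<bar>" using True by simp
      then show ?thesis by blast
    next
      case False
      show ?thesis
      proof (rule ccontr)
        assume "\<not> ?thesis"
        then have lt: "\<bar>of_int y0 * x i - of_int (y i)\<bar> < residue x (Q n) powr w i" for i by (meson not_le)
        \<comment> \<open>For negative \<open>y0\<close> the vector is negated, since records
          concern positive denominators.\<close>
        have "\<bar>of_int \<bar>y0\<bar> * x i - of_int ((if y0 < 0 then - y i else y i))\<bar> < residue x (Q n) powr w i" for i
          using lt[of i] by (auto simp: abs_if[of y0] abs_minus_commute)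
        then have "residue x \<bar>y0\<bar> < residue x (Q n)" by (intro residue_less rpos Qpos)
        moreover have "residue x (Q n) \<le> residue x \<bar>y0\<bar>" using False y(2) by (intro Qstep(4)) auto
        ultimately show False by simp
      qed
    qed
  qed
  have gp': "gap x (Q n) (residue x (Q n))" for n
    using gp[of n] Qstep(1)[of n] by (auto simp: gap_def)
  have sc: "consecutive \<epsilon> (v n) (v (Suc n))" for n
    unfolding consecutive_def
  proof (intro exI conjI)
    show "0 < residue x (Q n)" using rpos Qpos by simp
    show "residue x (Q n) * of_int (snd (v (Suc n))) < \<epsilon>" using rQ by (simp add: v_def)
    show "snd (v n) < snd (v (Suc n))" using Qstep(1) by (simp add: v_def)
    show "close x (v n) (residue x (Q n))" "close x (v (Suc n)) (residue x (Q n))" by (auto intro: cl)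
    show "gap x (snd (v (Suc n))) (residue x (Q n))" using gp by (simp add: v_def)
  qed
  \<comment> \<open>If the form vanished at all late terms, then \<open>Q m * H\<close> would be a
    sum of bounded deviations, where \<open>H\<close> is the nonzero value of the affine form at
    \<open>x\<close>; but \<open>Q m\<close> is unbounded.\<close>
  have leave: "\<exists>m\<ge>a. lin \<xi> \<xi>0 (v (Suc m)) \<noteq> 0" if xi: "\<xi> \<noteq> (\<lambda>_. 0)" for \<xi> \<xi>0 a
  proof (rule ccontr)
    assume "\<not> ?thesis"
    then have z: "lin \<xi> \<xi>0 (v (Suc m)) = 0" if "a \<le> m" for m using that by blast
    define H where "H = (\<Sum>i\<in>UNIV. of_int (\<xi> i) * x i) + of_int \<xi>0"
    define S where "S = (\<Sum>i\<in>UNIV. \<bar>real_of_int (\<xi> i)\<bar>)"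
    have H: "H \<noteq> 0" unfolding H_def by (rule irr[OF xi])
    have "real (Suc m) * \<bar>H\<bar> \<le> S" if m: "a \<le> m" for m
    proof -
      have eq: "(\<Sum>i\<in>UNIV. of_int (\<xi> i) * (of_int (fst (v (Suc m)) i) - of_int (Q (Suc m)) * x i)) = - (of_int (Q (Suc m)) * H)"
        using lin_deviation[of \<xi> "v (Suc m)" x \<xi>0] z[OF m] by (simp add: H_def v_def)
      have "real (Suc m) * \<bar>H\<bar> \<le> of_int (Q (Suc m)) * \<bar>H\<bar>"
        using Qge[of "Suc m"] by (intro mult_right_mono) linarith+
      also have "\<dots> = \<bar>- (of_int (Q (Suc m)) * H)\<bar>" using Qpos[of "Suc m"] by (simp add: abs_mult)
      also have "\<dots> \<le> (\<Sum>i\<in>UNIV. \<bar>of_int (\<xi> i) * (of_int (fst (v (Suc m)) i) - of_int (Q (Suc m)) * x i)\<bar>)"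
        unfolding eq[symmetric] by (rule sum_abs)
      also have "\<dots> \<le> S" unfolding S_def
      proof (rule sum_mono)
        fix i
        have "\<bar>of_int (Q (Suc m)) * x i - of_int (fst (v (Suc m)) i)\<bar> \<le> residue x (Q (Suc m)) powr w i"
          using cl[of "Suc m" "Suc m"] by (simp add: close_def v_def)
        also have "\<dots> \<le> 1" using r1 residue_nonneg w_pos[of i] by (intro powr_le1) auto
        finally have "\<bar>real_of_int (\<xi> i)\<bar> * \<bar>of_int (fst (v (Suc m)) i) - of_int (Q (Suc m)) * x i\<bar> \<le> \<bar>real_of_int (\<xi> i)\<bar> * 1"
          by (intro mult_left_mono) (auto simp: abs_minus_commute)
        then show "\<bar>of_int (\<xi> i) * (of_int (fst (v (Suc m)) i) - of_int (Q (Suc m)) * x i)\<bar> \<le> \<bar>real_of_int (\<xi> i)\<bar>"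
          by (simp add: abs_mult)
      qed
      finally show ?thesis .
    qed
    note bd = this
    obtain m0 where m0: "S / \<bar>H\<bar> < real m0" using reals_Archimedean2 by blast
    define m where "m = max a m0"
    have "real m0 \<le> real (Suc m)" by (simp add: m_def)
    then have "S / \<bar>H\<bar> < real (Suc m)" using m0 by linarith
    then have "S < real (Suc m) * \<bar>H\<bar>" using H by (simp add: divide_less_eq)
    then show False using bd[of m] by (simp add: m_def)
  qed
  have next_index: "\<exists>b. transition \<epsilon> (v a) (v b)" for a
  proof -
    let ?P = "\<lambda>m. a \<le> m \<and> dual_lin (v a) (v (Suc m)) \<noteq> 0"
    have qa: "snd (v a) > 0" using Qpos by (simp add: v_def)
    have ex: "\<exists>m. ?P m" using leave[OF dual(1)[OF qa]] by blast
    \<comment> \<open>This is the last index before the sequence first leaves the dual hyperplane of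
      \<open>v a\<close>. For \<open>m > a\<close> minimality puts \<open>v m\<close> in this
      hyperplane, and for \<open>m = a\<close> the choice of the hyperplane does.\<close>
    define m where "m = (LEAST m. ?P m)"
    have m: "?P m" unfolding m_def by (rule LeastI_ex[OF ex])
    have zero: "dual_lin (v a) (v m) = 0"
    proof (cases "m = a")
      case True then show ?thesis using dual(3)[OF qa] by simp
    next
      case False
      then obtain k where k: "m = Suc k" "a \<le> k" using m by (cases m) auto
      have "\<not> ?P k" using not_less_Least[of k ?P] k(1) by (simp add: m_def)
      then show ?thesis using k by simp
    qed
    have "transition \<epsilon> (v a) (v (Suc m))"
      unfolding transition_def
    proof (intro conjI exI[of _ "v m"] exI[of _ x] exI[of _ "residue x (Q a)"])
      show "0 < snd (v a)" by (rule qa)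
      show "0 < residue x (Q a)" using rpos Qpos by simp
      show "residue x (Q a) * of_int (snd (v a)) < \<epsilon>" using rQ' by (simp add: v_def)
      show "close x (v a) (residue x (Q a))" by (rule cl) simp
      show "gap x (snd (v a)) (residue x (Q a))" using gp' by (simp add: v_def)
      show "close x (v m) (residue x (Q a))" using m by (intro cl) simp
      show "snd (v a) \<le> snd (v m)" using m Qmono by (simp add: v_def)
    qed (use zero sc m in auto)
    then show ?thesis by blast
  qed
  obtain nx where nx: "\<And>a. transition \<epsilon> (v a) (v (nx a))" using next_index by metis
  define V where "V n = v ((nx ^^ n) 0)" for n
  have "transition \<epsilon> (V n) (V (Suc n))" for n using nx by (simp add: V_def)
  moreover have "in_box x (v n)" for n
    unfolding in_box_def
  proof
    fix i
    let ?q = "real_of_int (Q n)"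
    have q: "?q > 0" using Qpos by simp
    have "\<bar>?q * x i - of_int (nearest x (Q n) i)\<bar> \<le> residue x (Q n) powr w i"
      using cl[of n n] by (simp add: close_def v_def)
    also have "\<dots> \<le> (1 / ?q) powr w i"
    proof -
      have "residue x (Q n) * ?q \<le> 1" using rQ'[of n] eps by simp
      then have "residue x (Q n) \<le> 1 / ?q" using q by (simp add: pos_le_divide_eq)
      then show ?thesis using residue_nonneg w_pos[of i] by (intro powr_mono2) auto
    qed
    finally have le: "\<bar>?q * x i - of_int (nearest x (Q n) i)\<bar> \<le> (1 / ?q) powr w i" .
    have "x i - of_int (nearest x (Q n) i) / ?q = (?q * x i - of_int (nearest x (Q n) i)) / ?q"
      using q by (simp add: field_simps)
    then have "\<bar>x i - of_int (nearest x (Q n) i) / ?q\<bar> \<le> (1 / ?q) powr w i / ?q"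
      using le q by (simp add: abs_divide divide_right_mono)
    also have "\<dots> = ?q powr (- 1 - w i)"
      using q by (simp add: powr_diff powr_minus powr_divide divide_simps)
    finally show "\<bar>x i - of_int (fst (v n) i) / of_int (snd (v n))\<bar> \<le> of_int (snd (v n)) powr (- 1 - w i)"
      by (simp add: v_def)
  qed
  then have "in_box x (V n)" for n by (simp add: V_def)
  ultimately show ?thesis by blast
qed

section \<open>The tree of transitions\<close>

primrec gen :: "real \<Rightarrow> 'd point \<Rightarrow> nat \<Rightarrow> 'd point set" where
  "gen \<epsilon> v0 0 = {v0}"
| "gen \<epsilon> v0 (Suc n) = {z. \<exists>v\<in>gen \<epsilon> v0 n. transition \<epsilon> v z}"

text \<open>Transitions start at positive denominators and increase them. The root \<open>v0\<close>
  is arbitrary, hence the bound begins with generation 1.\<close>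

lemma gen_denominator: "v \<in> gen \<epsilon> v0 (Suc n) \<Longrightarrow> snd v \<ge> int (Suc n)"
proof (induction n arbitrary: v)
  case 0
  then show ?case using transition_denominator_less by fastforce
next
  case (Suc n)
  then obtain u where "u \<in> gen \<epsilon> v0 (Suc n)" "transition \<epsilon> u v" by (auto simp del: gen.simps simp: gen.simps(2)[of _ _ "Suc n"])
  then show ?case using Suc.IH[of u] transition_denominator_less[of \<epsilon> u v] by linarith
qed

text \<open>Each point of \<open>F\<close> is assigned to one parent, which splits the sum into
  groups of siblings, and \<open>half\<close> gains a factor 1/2 per generation. Finite subsets are
  summed because a generation may be infinite.\<close>

lemma gen_sum:
  fixes s :: real
  assumes half: "\<And>v F. finite F \<Longrightarrow> (\<And>z. z \<in> F \<Longrightarrow> transition \<epsilon> v z) \<Longrightarrow> snd v > 0 \<Longrightarrow>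
      (\<Sum>z\<in>F. of_int (snd z) powr (- s)) \<le> 1 / 2 * of_int (snd v) powr (- s)"
    and F: "finite F" "F \<subseteq> gen \<epsilon> v0 n"
  shows "(\<Sum>z\<in>F. of_int (snd z) powr (- s)) \<le> (1 / 2) ^ n * of_int (snd v0) powr (- s)"
  using F
proof (induction n arbitrary: F)
  case 0
  then have "F = {} \<or> F = {v0}" by auto
  then show ?case by auto
next
  case (Suc n)
  have "\<forall>z\<in>F. \<exists>v\<in>gen \<epsilon> v0 n. transition \<epsilon> v z" using Suc.prems by auto
  then obtain par where par: "\<And>z. z \<in> F \<Longrightarrow> par z \<in> gen \<epsilon> v0 n \<and> transition \<epsilon> (par z) z" by metis
  have "(\<Sum>z\<in>F. real_of_int (snd z) powr (- s)) = (\<Sum>v\<in>par ` F. \<Sum>z\<in>{z \<in> F. par z = v}. of_int (snd z) powr (- s))"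
    by (rule sum.image_gen[OF Suc.prems(1)])
  also have "\<dots> \<le> (\<Sum>v\<in>par ` F. 1 / 2 * of_int (snd v) powr (- s))"
  proof (rule sum_mono)
    fix v assume "v \<in> par ` F"
    then have "snd v > 0" using par transition_denominator_less by blast
    then show "(\<Sum>z\<in>{z \<in> F. par z = v}. of_int (snd z) powr (- s)) \<le> 1 / 2 * of_int (snd v) powr (- s)"
      using Suc.prems(1) par by (intro half) auto
  qed
  also have "\<dots> = 1 / 2 * (\<Sum>v\<in>par ` F. of_int (snd v) powr (- s))" by (simp add: sum_distrib_left)
  also have "\<dots> \<le> 1 / 2 * ((1 / 2) ^ n * of_int (snd v0) powr (- s))"
    using Suc.prems(1) par by (intro mult_left_mono Suc.IH) auto
  finally show ?case by simp
qed

definition path_set :: "real \<Rightarrow> 'd point \<Rightarrow> (real ^ 'd) set" where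
  "path_set \<epsilon> v0 = {x. \<exists>V. V 0 = v0 \<and> (\<forall>n. transition \<epsilon> (V n) (V (Suc n)) \<and> in_box (($) x) (V n))}"

text \<open>Every box of generation \<open>n\<close> is cut into cubes of side
  \<open>q powr (- 1 - w1)\<close>. Since the weights add up to 1, this takes
  \<open>O(q powr (d * w1 - 1))\<close> cubes, and the equation for \<open>D\<close> makes the sum
  of their \<open>D\<close>-th powers \<open>O(q powr (- s))\<close>, which \<open>gen_sum\<close>
  controls.\<close>

lemma null_cover_path_set:
  fixes s :: real
  assumes half: "\<And>v F. finite F \<Longrightarrow> (\<And>z. z \<in> F \<Longrightarrow> transition \<epsilon> v z) \<Longrightarrow> snd v > 0 \<Longrightarrow>
      (\<Sum>z\<in>F. of_int (snd z) powr (- s)) \<le> 1 / 2 * of_int (snd v) powr (- s)"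
    and w1: "\<And>i. w i \<le> w1" and D: "D > 0" "(1 + w1) * D = s + d * w1 - 1"
  shows "null_cover D (path_set \<epsilon> v0)"
proof (rule null_coverI[OF D(1)])
  fix \<delta> \<eta> :: real assume del: "\<delta> > 0" and eta: "\<eta> > 0"
  have w1pos: "w1 > 0" using w1[of undefined] w_pos[of undefined] by linarith
  define C where "C = 6 ^ CARD('d) * d powr D * of_int (snd v0) powr (- s)"
  have "((\<lambda>n. C * (1 / 2) ^ n) \<longlongrightarrow> C * 0) sequentially"
    by (intro tendsto_mult_left LIMSEQ_power_zero) auto
  then have ev1: "\<forall>\<^sub>F n in sequentially. C * (1 / 2) ^ n < \<eta>"
    using eta by (intro order_tendstoD) auto
  have "((\<lambda>n. d * inverse (real n)) \<longlongrightarrow> d * 0) sequentially"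
    by (intro tendsto_mult_left lim_inverse_n)
  then have ev2: "\<forall>\<^sub>F n in sequentially. d * inverse (real n) < \<delta>"
    using del by (intro order_tendstoD) auto
  have "\<forall>\<^sub>F n in sequentially. n \<ge> 1 \<and> C * (1 / 2) ^ n < \<eta> \<and> d * inverse (real n) < \<delta>"
    using ev1 ev2 eventually_ge_at_top[of 1] by eventually_elim auto
  then obtain n where n: "n \<ge> 1" "C * (1 / 2) ^ n < \<eta>" "d * inverse (real n) < \<delta>"
    using eventually_happens'[OF sequentially_bot] by blast
  define l where "l v = real_of_int (snd v) powr (- 1 - w1)" for v :: "'d point"
  define t where "t v i = of_int (fst v i) / real_of_int (snd v)" for v :: "'d point" and i
  \<comment> \<open>In units of \<open>l v\<close> the box has half-width
    \<open>q powr (w1 - w i)\<close>; the summand 1 allows for the floor in the cell index.\<close>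
  define W where "W v i = real_of_int (snd v) powr (w1 - w i) + 1" for v :: "'d point" and i
  define K where "K v = {k :: 'd \<Rightarrow> int. \<forall>i. \<bar>of_int (k i) - (0 :: real)\<bar> \<le> W v i}" for v
  define J where "J = Sigma (gen \<epsilon> v0 n) K"
  define U where "U j = grid_cell (t (fst j)) (l (fst j)) (snd j)" for j
  have q: "snd v \<ge> int n" if "v \<in> gen \<epsilon> v0 n" for v
    using gen_denominator[of v \<epsilon> v0 "n - 1"] that n(1) by simp
  have l: "l v > 0" "l v \<le> inverse (real n)" "snd v > 0" if v: "v \<in> gen \<epsilon> v0 n" for v
  proof -
    have q1: "1 \<le> real n" "real n \<le> real_of_int (snd v)" using q[OF v] n(1) by linarith+
    then show "snd v > 0" by linarith
    then show "l v > 0" by (simp add: l_def)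
    have "l v \<le> real_of_int (snd v) powr (- 1)" unfolding l_def using q1 w1pos by (intro powr_mono) auto
    also have "\<dots> \<le> real n powr (- 1)" using q1 by (intro powr_mono2') auto
    finally show "l v \<le> inverse (real n)" using q1 by (simp add: powr_minus)
  qed
  have K: "finite (K v)" "real (card (K v)) \<le> 6 ^ CARD('d) * real_of_int (snd v) powr (d * w1 - 1)"
    if v: "v \<in> gen \<epsilon> v0 n" for v
  proof -
    have W0: "0 \<le> W v i" for i by (simp add: W_def add_nonneg_nonneg)
    show "finite (K v)" unfolding K_def by (rule card_int_box(1)[of "W v" "\<lambda>_. 0", OF W0])
    have q1: "real_of_int (snd v) \<ge> 1" using l(3)[OF v] by linarith
    have "real (card (K v)) \<le> (\<Prod>i\<in>UNIV. 2 * W v i + 2)"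
      unfolding K_def by (rule card_int_box(2)[of "W v" "\<lambda>_. 0", OF W0])
    also have "\<dots> \<le> (\<Prod>i\<in>UNIV. 6 * real_of_int (snd v) powr (w1 - w i))"
    proof (rule prod_mono)
      fix i :: 'd
      have "1 \<le> real_of_int (snd v) powr (w1 - w i)" using q1 w1[of i] by (intro ge_one_powr_ge_zero) auto
      then show "0 \<le> 2 * W v i + 2 \<and> 2 * W v i + 2 \<le> 6 * real_of_int (snd v) powr (w1 - w i)"
        by (simp add: W_def)
    qed
    also have "\<dots> = 6 ^ CARD('d) * real_of_int (snd v) powr (\<Sum>i\<in>UNIV. w1 - w i)"
      using q1 by (simp add: prod.distrib powr_sum)
    also have "(\<Sum>i\<in>UNIV. w1 - w i) = d * w1 - 1" by (simp add: sum_subtractf w_sum d_def)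
    finally show "real (card (K v)) \<le> 6 ^ CARD('d) * real_of_int (snd v) powr (d * w1 - 1)" .
  qed
  have vsum: "(\<Sum>k\<in>K v. diameter (U (v, k)) powr D) \<le> 6 ^ CARD('d) * d powr D * real_of_int (snd v) powr (- s)"
    if v: "v \<in> gen \<epsilon> v0 n" for v
  proof -
    have q1: "real_of_int (snd v) \<ge> 1" using l(3)[OF v] by linarith
    have "(\<Sum>k\<in>K v. diameter (U (v, k)) powr D) \<le> (\<Sum>k\<in>K v. (d * l v) powr D)"
      unfolding d_def by (intro sum_mono) (simp add: U_def diameter_grid_cell_powr l(1)[OF v] D(1))
    also have "\<dots> = real (card (K v)) * (d * l v) powr D" by simp
    also have "\<dots> \<le> (6 ^ CARD('d) * real_of_int (snd v) powr (d * w1 - 1)) * (d * l v) powr D"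
      by (intro mult_right_mono K v) auto
    also have "(d * l v) powr D = d powr D * real_of_int (snd v) powr (- ((1 + w1) * D))"
      using d_ge q1 by (simp add: l_def powr_mult powr_powr algebra_simps)
    also have "(6 ^ CARD('d) * real_of_int (snd v) powr (d * w1 - 1)) * (d powr D * real_of_int (snd v) powr (- ((1 + w1) * D)))
      = 6 ^ CARD('d) * d powr D * (real_of_int (snd v) powr (d * w1 - 1) * real_of_int (snd v) powr (- ((1 + w1) * D)))"
      by simp
    also have "real_of_int (snd v) powr (d * w1 - 1) * real_of_int (snd v) powr (- ((1 + w1) * D)) = real_of_int (snd v) powr (- s)"
      unfolding powr_add[symmetric] D(2) by (rule arg_cong) simp
    finally show ?thesis .
  qed
  show "\<exists>(J :: ('d point \<times> ('d \<Rightarrow> int)) set) U. path_set \<epsilon> v0 \<subseteq> (\<Union>j\<in>J. U j)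
     \<and> (\<forall>j\<in>J. bounded (U j) \<and> diameter (U j) \<le> \<delta>)
     \<and> (\<forall>F. finite F \<and> F \<subseteq> J \<longrightarrow> (\<Sum>j\<in>F. diameter (U j) powr D) \<le> \<eta>)"
  proof (intro exI[of _ J] exI[of _ U] conjI ballI allI impI)
    show "path_set \<epsilon> v0 \<subseteq> (\<Union>j\<in>J. U j)"
    proof
      fix x assume "x \<in> path_set \<epsilon> v0"
      then obtain V where V: "V 0 = v0" "\<And>n. transition \<epsilon> (V n) (V (Suc n))" "\<And>n. in_box (($) x) (V n)"
        unfolding path_set_def by blast
      have "V m \<in> gen \<epsilon> v0 m" for m by (induction m) (use V in auto)
      then have v: "V n \<in> gen \<epsilon> v0 n" .
      define k where "k i = \<lfloor>(x $ i - t (V n) i) / l (V n)\<rfloor>" for i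
      have "\<bar>of_int (k i) - (0 :: real)\<bar> \<le> W (V n) i" for i
      proof -
        let ?q = "real_of_int (snd (V n))"
        have q0: "?q > 0" using l(3)[OF v] by simp
        have "\<bar>x $ i - t (V n) i\<bar> \<le> ?q powr (- 1 - w i)" using V(3)[of n] by (simp add: in_box_def t_def)
        then have "\<bar>(x $ i - t (V n) i) / l (V n)\<bar> \<le> ?q powr (- 1 - w i) / l (V n)"
          using l(1)[OF v] by (simp add: abs_divide divide_right_mono)
        also have "\<dots> = ?q powr (w1 - w i)" using q0 by (simp add: l_def flip: powr_diff)
        finally show ?thesis unfolding W_def k_def by linarith
      qed
      then have "(V n, k) \<in> J" using v by (simp add: J_def K_def)
      moreover have "x \<in> U (V n, k)" by (simp add: U_def grid_cell_def k_def)
      ultimately show "x \<in> (\<Union>j\<in>J. U j)" by blast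
    qed
  next
    fix j assume "j \<in> J"
    then have v: "fst j \<in> gen \<epsilon> v0 n" by (auto simp: J_def)
    show "bounded (U j)" unfolding U_def by (rule grid_cell[OF l(1)[OF v]])
    have "diameter (U j) \<le> d * l (fst j)" unfolding U_def d_def by (rule grid_cell[OF l(1)[OF v]])
    also have "\<dots> \<le> d * inverse (real n)" using l(2)[OF v] d_ge by (intro mult_left_mono) auto
    finally show "diameter (U j) \<le> \<delta>" using n(3) by linarith
  next
    fix F assume F: "finite F \<and> F \<subseteq> J"
    have sub: "fst ` F \<subseteq> gen \<epsilon> v0 n" using F by (auto simp: J_def)
    have finK: "\<forall>v\<in>fst ` F. finite (K v)" using K(1) sub by blast
    \<comment> \<open>\<open>F\<close> is enlarged to all cells of the boxes involved, so that
      \<open>vsum\<close> applies box by box.\<close>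
    have "(\<Sum>j\<in>F. diameter (U j) powr D) \<le> (\<Sum>j\<in>Sigma (fst ` F) K. diameter (U j) powr D)"
      by (rule sum_mono2) (use F finK in \<open>force simp: J_def\<close>)+
    also have "\<dots> = (\<Sum>v\<in>fst ` F. \<Sum>k\<in>K v. diameter (U (v, k)) powr D)"
      using F finK by (subst sum.Sigma) auto
    also have "\<dots> \<le> (\<Sum>v\<in>fst ` F. 6 ^ CARD('d) * d powr D * real_of_int (snd v) powr (- s))"
      using sub by (intro sum_mono vsum) auto
    also have "\<dots> = 6 ^ CARD('d) * d powr D * (\<Sum>v\<in>fst ` F. real_of_int (snd v) powr (- s))"
      by (simp add: sum_distrib_left)
    also have "\<dots> \<le> 6 ^ CARD('d) * d powr D * ((1 / 2) ^ n * of_int (snd v0) powr (- s))"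
      using F sub by (intro mult_left_mono gen_sum[OF half]) auto
    also have "\<dots> = C * (1 / 2) ^ n" by (simp add: C_def)
    finally show "(\<Sum>j\<in>F. diameter (U j) powr D) \<le> \<eta>" using n(2) by linarith
  qed
qed

section \<open>Covering the set and choosing the exponent\<close>

lemma DI_covered:
  fixes W :: "real ^ 'd"
  assumes W: "\<And>i. W $ i = w i" and eps: "0 < \<epsilon>" "\<epsilon> \<le> 1"
  shows "DI W \<epsilon> \<subseteq> (\<Union>(\<xi>, \<xi>0). if \<xi> = (\<lambda>_. 0) then {} else {x. (\<Sum>i\<in>UNIV. of_int (\<xi> i) * x $ i) + of_int \<xi>0 = 0})
     \<union> (\<Union>v0. path_set \<epsilon> v0)"
proof
  fix x assume x: "x \<in> DI W \<epsilon>"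
  show "x \<in> (\<Union>(\<xi>, \<xi>0). if \<xi> = (\<lambda>_. 0) then {} else {x. (\<Sum>i\<in>UNIV. of_int (\<xi> i) * x $ i) + of_int \<xi>0 = 0})
     \<union> (\<Union>v0. path_set \<epsilon> v0)"
  proof (cases "\<exists>\<xi> \<xi>0. \<xi> \<noteq> (\<lambda>_. 0) \<and> (\<Sum>i\<in>UNIV. of_int (\<xi> i) * x $ i) + of_int \<xi>0 = 0")
    case True
    then obtain \<xi> \<xi>0 where "\<xi> \<noteq> (\<lambda>_. 0)" "(\<Sum>i\<in>UNIV. of_int (\<xi> i) * x $ i) + of_int \<xi>0 = 0" by blast
    then show ?thesis by (intro UnI1 UN_I[of "(\<xi>, \<xi>0)"]) auto
  next
    case False
    obtain T0 where T0: "\<And>T. T \<ge> T0 \<Longrightarrow> \<exists>(p :: int ^ 'd) (q :: nat). 0 < q \<and> real q < T \<and>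
       wnorm W (real q *\<^sub>R x - (\<chi> i. real_of_int (p $ i))) < \<epsilon> / T"
      using x unfolding DI_def eventually_at_top_linorder by blast
    \<comment> \<open>The maximum with 1 makes \<open>T\<close> and \<open>\<epsilon> / T\<close>
      positive, as \<open>residue_less\<close> requires.\<close>
    have "\<exists>q. 0 < q \<and> of_int q < T \<and> residue (($) x) q < \<epsilon> / T" if T: "T \<ge> max T0 1" for T
    proof -
      obtain p :: "int ^ 'd" and q :: nat where q: "0 < q" "real q < T"
        "wnorm W (real q *\<^sub>R x - (\<chi> i. real_of_int (p $ i))) < \<epsilon> / T"
        using T0[of T] T by auto
      have e: "\<epsilon> / T > 0" using eps T by simp
      have "\<bar>of_int (int q) * x $ i - of_int (p $ i)\<bar> < (\<epsilon> / T) powr w i" for i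
      proof -
        let ?y = "\<bar>real q * x $ i - of_int (p $ i)\<bar>"
        have "?y powr (1 / w i) \<le> wnorm W (real q *\<^sub>R x - (\<chi> i. real_of_int (p $ i)))"
          unfolding wnorm_def by (rule Max_ge) (auto simp: W)
        then have "?y powr (1 / w i) < \<epsilon> / T" using q(3) by linarith
        then have "(?y powr (1 / w i)) powr w i < (\<epsilon> / T) powr w i"
          using w_pos[of i] by (intro powr_less_mono2) auto
        then show ?thesis using w_pos[of i] by (simp add: powr_powr)
      qed
      then have "residue (($) x) (int q) < \<epsilon> / T" by (rule residue_less[OF e])
      then show ?thesis using q(1,2) by (intro exI[of _ "int q"]) auto
    qed
    then obtain V where V: "\<And>n. transition \<epsilon> (V n) (V (Suc n)) \<and> in_box (($) x) (V n)"
      using transition_path[OF eps, of "($) x" "max T0 1"] False by blast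
    then have "x \<in> path_set \<epsilon> (V 0)" unfolding path_set_def by blast
    then show ?thesis by blast
  qed
qed

text \<open>The condition \<open>small\<close> halves the weight from one generation to the next.
  The exponent \<open>D\<close> solves the equation in \<open>null_cover_path_set\<close> for
  \<open>s = d + \<kappa>\<close>, and it exceeds \<open>d - 1\<close>, so the countably many
  rational hyperplanes are null sets too.\<close>

lemma hausdorff_dim_DI:
  fixes W :: "real ^ 'd"
  assumes W: "\<And>i. W $ i = w i" and w1: "\<And>i. w i \<le> w1"
    and eps: "0 < \<epsilon>" "\<epsilon> \<le> 1" and kap: "0 < \<kappa>" "\<kappa> \<le> 1"
    and small: "transition_const * (\<epsilon> / \<kappa>\<^sup>2 + \<epsilon> powr (wmin / 2)) \<le> 1 / 2"
  shows "hausdorff_dim (DI W \<epsilon>) \<le> ereal (d - 1 / (1 + w1) + \<kappa>)"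
proof -
  have w1pos: "w1 > 0" using w1[of undefined] w_pos[of undefined] by linarith
  define D where "D = (d + \<kappa> + d * w1 - 1) / (1 + w1)"
  have Deq: "(1 + w1) * D = d + \<kappa> + d * w1 - 1" using w1pos by (simp add: D_def)
  have D': "D = d - 1 / (1 + w1) + \<kappa> / (1 + w1)"
  proof -
    have "d + \<kappa> + d * w1 - 1 = d * (1 + w1) - 1 + \<kappa>" by (simp add: algebra_simps)
    then have "D = (d * (1 + w1) - 1 + \<kappa>) / (1 + w1)" by (simp only: D_def)
    also have "\<dots> = d - 1 / (1 + w1) + \<kappa> / (1 + w1)"
      using w1pos by (simp add: add_divide_distrib diff_divide_distrib)
    finally show ?thesis .
  qed
  have "1 / (1 + w1) < 1" "\<kappa> / (1 + w1) > 0" using w1pos kap by (auto simp: divide_less_eq)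
  then have D1: "D > d - 1" using D' by linarith
  then have D0: "D > 0" using d_ge by linarith
  have half: "(\<Sum>z\<in>F. of_int (snd z) powr (- (d + \<kappa>))) \<le> 1 / 2 * of_int (snd v) powr (- (d + \<kappa>))"
    if "finite F" "\<And>z. z \<in> F \<Longrightarrow> transition \<epsilon> v z" "snd v > 0" for v F
  proof -
    have "(\<Sum>z\<in>F. of_int (snd z) powr (- (d + \<kappa>)))
      \<le> transition_const * (\<epsilon> / \<kappa>\<^sup>2 + \<epsilon> powr (wmin / 2)) * of_int (snd v) powr (- (d + \<kappa>))"
      by (rule transition_sum[OF kap eps that])
    also have "\<dots> \<le> 1 / 2 * of_int (snd v) powr (- (d + \<kappa>))" using small by (intro mult_right_mono) auto
    finally show ?thesis .
  qed
  have paths: "null_cover D (\<Union>v0. path_set \<epsilon> v0)"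
  proof (rule null_cover_countable)
    show "null_cover D (path_set \<epsilon> v0)" for v0
      by (rule null_cover_path_set[OF half w1 D0 Deq])
  qed
  have hyper: "null_cover D (\<Union>(\<xi>, \<xi>0). if \<xi> = (\<lambda>_. 0) then {}
      else {x :: real ^ 'd. (\<Sum>i\<in>UNIV. of_int (\<xi> i) * x $ i) + of_int \<xi>0 = 0})"
  proof (rule null_cover_countable)
    fix j :: "('d \<Rightarrow> int) \<times> int"
    obtain \<xi> \<xi>0 where j: "j = (\<xi>, \<xi>0)" by (cases j)
    have "null_cover D {x :: real ^ 'd. (\<Sum>i\<in>UNIV. of_int (\<xi> i) * x $ i) + of_int \<xi>0 = 0}" if "\<xi> \<noteq> (\<lambda>_. 0)"
    proof (rule null_cover_hyperplane)
      show "(\<lambda>i. real_of_int (\<xi> i)) \<noteq> (\<lambda>_. 0)" using that by (auto simp: fun_eq_iff)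
      show "D > real CARD('d) - 1" using D1 by (simp add: d_def)
    qed
    then show "null_cover D (case j of (\<xi>, \<xi>0) \<Rightarrow> if \<xi> = (\<lambda>_. 0) then {}
      else {x :: real ^ 'd. (\<Sum>i\<in>UNIV. of_int (\<xi> i) * x $ i) + of_int \<xi>0 = 0})"
      by (simp add: j null_cover_empty)
  qed
  have "null_cover D (DI W \<epsilon>)"
    by (rule null_cover_subset[OF null_cover_Un[OF hyper paths] DI_covered[OF W eps]])
  then have "hausdorff_measure D (DI W \<epsilon>) = 0" by (rule hausdorff_measure_null)
  then have "hausdorff_dim (DI W \<epsilon>) \<le> ereal D"
    unfolding hausdorff_dim_def using D0 by (intro INF_lower) auto
  also have "\<kappa> / (1 + w1) \<le> \<kappa>" using w1pos kap by (simp add: divide_le_eq)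
  then have "ereal D \<le> ereal (d - 1 / (1 + w1) + \<kappa>)" using D' by simp
  finally show ?thesis .
qed

end

theorem theorem1p2:
  fixes w :: "real ^ 'd::{finite,linorder}"
  assumes "CARD('d) \<ge> 2"
    and "\<And>i j. i \<le> j \<Longrightarrow> w $ j \<le> w $ i"
    and "\<And>i. 0 < w $ i"
    and "(\<Sum>i\<in>UNIV. w $ i) = 1"
  shows "\<exists>C>0. \<exists>\<epsilon>\<^sub>0>0. \<forall>\<epsilon>. 0 < \<epsilon> \<and> \<epsilon> < \<epsilon>\<^sub>0 \<longrightarrow>
    hausdorff_dim (DI w \<epsilon>) \<le>
      ereal (real CARD('d) - 1 / (1 + w $ Min UNIV) + C * sqrt \<epsilon>)"
proof -
  interpret weights "\<lambda>i. w $ i" "real CARD('d)"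
    using assms(3,4) by unfold_locales auto
  \<comment> \<open>The weights are nonincreasing, so the least index carries the largest
    one.\<close>
  have w1: "w $ i \<le> w $ Min UNIV" for i by (rule assms(2)) simp
  \<comment> \<open>With \<open>\<kappa> = C * sqrt \<epsilon>\<close> this value makes
    \<open>transition_const * \<epsilon> / \<kappa>^2\<close> equal to 1/4.\<close>
  define C where "C = 2 * sqrt transition_const"
  have C: "C > 0" "C\<^sup>2 = 4 * transition_const" using transition_const_pos by (auto simp: C_def power_mult_distrib)
  \<comment> \<open>The three bounds give, in this order, \<open>\<epsilon> <= 1\<close>,
    \<open>\<kappa> <= 1\<close>, and at most 1/4 for the second term in the condition
    \<open>small\<close>.\<close>
  define e0 where "e0 = min 1 (min (1 / C\<^sup>2) ((1 / (4 * transition_const)) powr (2 / wmin)))"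
  have e0: "e0 > 0" using C transition_const_pos by (simp add: e0_def)
  have "hausdorff_dim (DI w \<epsilon>) \<le> ereal (real CARD('d) - 1 / (1 + w $ Min UNIV) + C * sqrt \<epsilon>)"
    if e: "0 < \<epsilon>" "\<epsilon> < e0" for \<epsilon>
  proof (rule hausdorff_dim_DI)
    show "\<epsilon> \<le> 1" "0 < \<epsilon>" using e by (auto simp: e0_def)
    show "0 < C * sqrt \<epsilon>" using C e by simp
    have "\<epsilon> \<le> 1 / C\<^sup>2" using e by (simp add: e0_def)
    then have "(C * sqrt \<epsilon>)\<^sup>2 \<le> 1" using e C(1) by (simp add: power_mult_distrib field_simps)
    then have "\<bar>C * sqrt \<epsilon>\<bar> \<le> 1" by (simp only: abs_square_le_1)
    then show "C * sqrt \<epsilon> \<le> 1" by linarith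
    have "\<epsilon> powr (wmin / 2) \<le> ((1 / (4 * transition_const)) powr (2 / wmin)) powr (wmin / 2)"
      using e wmin(1) by (intro powr_mono2) (auto simp: e0_def)
    also have "\<dots> = 1 / (4 * transition_const)" using wmin(1) transition_const_pos by (simp add: powr_powr)
    finally have "transition_const * \<epsilon> powr (wmin / 2) \<le> 1 / 4" using transition_const_pos by (simp add: field_simps)
    moreover have "transition_const * (\<epsilon> / (C * sqrt \<epsilon>)\<^sup>2) = 1 / 4"
      using e C transition_const_pos by (simp add: power_mult_distrib)
    ultimately show "transition_const * (\<epsilon> / (C * sqrt \<epsilon>)\<^sup>2 + \<epsilon> powr (wmin / 2)) \<le> 1 / 2"
      by (simp add: distrib_left)
  qed (use w1 in auto)
  then show ?thesis using C(1) e0 by blast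
qed

end
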